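(* Let $k$ be a positive even integer and let $(n,p)=(3,2)$, $k\ge4$ or $(n,p)=(5,4)$, $k\ge6$. Let $\lambda=\sqrt{\frac{k(k+n-1)}{p}}$ and $\varphi_0=\sqrt{\frac{p-n\lambda^{-2}}{n-p}}$. Then there exist a smooth solution $t\in\mathbb R\mapsto(\varphi(t),\psi(t))$ to the autonomous system $$\begin{cases}\varphi_t=\psi,\\ \psi_t=-\psi-\Big[\big(n-p+\frac{p}{1+\lambda^2\varphi^2}\big)\psi+\big(n-p+\frac{(1-\lambda^2)p}{1+\lambda^2\varphi^2}\big)\varphi\Big]\big[1+(\varphi+\psi)^2\big],\end{cases}$$ and a strictly increasing sequence $\{T_i:i\in\mathbb Z^+\}$ in $\mathbb R$ such that: - $\lim_{t\to-\infty}(\varphi(t),\psi(t))=(0,0)$; - $\varphi(t)=O(e^{(k-1)t})$ and $\psi(t)=O(e^{(k-1)t})$ as $t\to-\infty$; - $\lim_{t\to+\infty}(\varphi(t),\psi(t))=(\varphi_0,0)$; - $\lim_{i\to\infty}T_i=+\infty$; - $\psi(T_i)=0$ for all $i\in\mathbb Z^+$; - with $\varphi_i:=\varphi(T_i)$ for $i\in\mathbb Z^+$, $\{\varphi_{2m-1}:m\in\mathbb Z^+\}$ is strictly decreasing and $\{\varphi_{2m}:m\in\mathbb Z^+\}$ is strictly increasing, with the common limit $\varphi_0$; - $\psi(t)>0$ for $t\in(-\infty,T_1)\cup\bigcup_{m\in\mathbb Z^+}(T_{2m},T_{2m+1})$; - $\psi(t)<0$ for $t\in\bigcup_{m\in\mathbb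 Z^+}(T_{2m-1},T_{2m})$; - $(\varphi+\psi)(t)>0$ for all $t\in\mathbb R$. Namely, the orbit of this solution tends to the saddle point $(0,0)$ as $t\to-\infty$ and spins around the spiral point $(\varphi_0,0)$ as $t\to+\infty$.
   Context: Subscript $t$ denotes $d/dt$; $\mathbb Z^+=\{1,2,3,\dots\}$. The points $(0,0)$ and $(\varphi_0,0)$ are critical points (zeros of the right-hand side) of the system. The triples $(n,p,k)$ are types of the maps called LOMSEs in the paper, for which $k$ is always a positive even integer. *)

theory Defs
  imports "HOL-Analysis.Analysis" "HOL-Library.Landau_Symbols"
begin

definition smooth :: "(real \<Rightarrow> real) \<Rightarrow> bool" where
  "smooth f \<longleftrightarrow> (\<forall>m t. ((deriv ^^ m) f) differentiable (at t))"

definition psi_rhs :: "nat \<Rightarrow> nat \<Rightarrow> real \<Rightarrow> real \<Rightarrow> real \<Rightarrow> real" where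
  "psi_rhs n p lam x y =
     - y - ((real n - real p + real p / (1 + lam\<^sup>2 * x\<^sup>2)) * y
            + (real n - real p + (1 - lam\<^sup>2) * real p / (1 + lam\<^sup>2 * x\<^sup>2)) * x)
           * (1 + (x + y)\<^sup>2)"

definition system_field :: "nat \<Rightarrow> nat \<Rightarrow> real \<Rightarrow> real^2 \<Rightarrow> real^2" where
  "system_field n p lam z = vector [z $ 2, psi_rhs n p lam (z $ 1) (z $ 2)]"

definition critical_point :: "(real^'n \<Rightarrow> real^'n) \<Rightarrow> real^'n \<Rightarrow> bool" where
  "critical_point F z \<longleftrightarrow> F z = 0"

definition linearization_eigenvalues :: "(real^'n \<Rightarrow> real^'n) \<Rightarrow> real^'n \<Rightarrow> complex set" where
  "linearization_eigenvalues F z =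
     {\<mu>. \<exists>v :: complex^'n. v \<noteq> 0 \<and>
            map_matrix complex_of_real (jacobian F (at z)) *v v = \<mu> *s v}"

definition saddle_point :: "(real^2 \<Rightarrow> real^2) \<Rightarrow> real^2 \<Rightarrow> bool" where
  "saddle_point F z \<longleftrightarrow> critical_point F z \<and> F differentiable (at z) \<and>
     (\<exists>a b :: real. a < 0 \<and> 0 < b \<and>
        linearization_eigenvalues F z = {complex_of_real a, complex_of_real b})"

text \<open>A spiral point (focus) has a pair of conjugate non-real eigenvalues off the imaginary
  axis; a purely imaginary pair (linear center) is excluded.\<close>

definition spiral_point :: "(real^2 \<Rightarrow> real^2) \<Rightarrow> real^2 \<Rightarrow> bool" where
  "spiral_point F z \<longleftrightarrow> critical_point F z \<and> F differentiable (at z) \<and>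
     (\<exists>\<mu>. Re \<mu> \<noteq> 0 \<and> Im \<mu> \<noteq> 0 \<and> linearization_eigenvalues F z = {\<mu>, cnj \<mu>})"

end

theory Submission
  imports Defs
begin

text \<open>Put \<open>w = \<phi> + \<psi>\<close>.  Since \<open>n = p + 1\<close>, the system becomes \<open>\<phi>' = w - \<phi>\<close> together with an
  equation for \<open>arctan w\<close> that makes it of Lienard type.  The orbit emanating from the origin is
  found by a contraction argument in eigencoordinates as functions of \<open>s = e\<^sup>t\<close>.  It enters a
  positively invariant box \<open>[c, M]\<^sup>2\<close> with \<open>c > 0\<close>, on which a strict Lyapunov function forces
  convergence to the equilibrium; on the line \<open>\<psi> = 0\<close> that function depends monotonically on the
  distance to \<open>\<phi>\<^sub>0\<close> on each side, so successive turning points on the same side get closer to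
  \<open>\<phi>\<^sub>0\<close>.  There are infinitely many turning points because near the equilibrium \<open>\<phi> - \<phi>\<^sub>0\<close> is an
  underdamped oscillator: \<open>- \<psi> / (\<phi> - \<phi>\<^sub>0)\<close> solves a Riccati equation that blows up in finite
  time.\<close>

section \<open>Singular Volterra equations\<close>

text \<open>Its roots are non-real iff \<open>(p + 2)^2 < 8 * (p + 1) / p * phi0^2\<close>. As
  \<open>phi0^2 = p - (p + 1) / lam^2\<close> stays below \<open>p\<close>, this requires
  \<open>(p + 2)^2 < 8 * (p + 1)\<close>, so \<open>p \<le> 4\<close>, and then \<open>k\<close>
  large enough. The same inequality yields the infinitely many turning points. The obstacle is
  global: the field grows cubically, so blow-up is not excluded a priori, and local analysis at the
  two critical points cannot tell whether the orbit leaving one ever approaches the other. Existence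
  for all times is therefore obtained from a truncated field, bounded and Lipschitz on the whole
  space, and barrier arguments show that the orbit never feels the truncation. The oscillation needs
  no linearization theorem: the equation for \<open>\<phi> - phi0\<close> is written exactly as a
  linear one whose coefficients are evaluated along the orbit, and only their limits matter.\<close>

definition bdd_lipschitz :: "('a::metric_space \<Rightarrow> real) \<Rightarrow> bool" where
  "bdd_lipschitz f \<longleftrightarrow> (\<exists>B. \<forall>z. \<bar>f z\<bar> \<le> B) \<and> (\<exists>L. L-lipschitz_on UNIV f)"

lemma bdd_lipschitzI:
  fixes f :: "'a::metric_space \<Rightarrow> real"
  assumes "\<And>z. \<bar>f z\<bar> \<le> B" and "\<And>y z. \<bar>f y - f z\<bar> \<le> L * dist y z"
  shows "bdd_lipschitz f"
proof -
  have "(max L 0)-lipschitz_on UNIV f"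
  proof (rule lipschitz_onI)
    fix y z :: 'a
    have "L * dist y z \<le> max L 0 * dist y z"
      by (intro mult_right_mono) auto
    then show "dist (f y) (f z) \<le> max L 0 * dist y z"
      using assms(2)[of y z] by (simp add: dist_real_def)
  qed auto
  then show ?thesis
    unfolding bdd_lipschitz_def using assms(1) by blast
qed

lemma bdd_lipschitzE:
  assumes "bdd_lipschitz f"
  obtains B L where "0 \<le> B" "0 \<le> L" "\<And>z. \<bar>f z\<bar> \<le> B" "\<And>y z. \<bar>f y - f z\<bar> \<le> L * dist y z"
proof -
  obtain B L where B: "\<And>z. \<bar>f z\<bar> \<le> B" and L: "L-lipschitz_on UNIV f"
    using assms unfolding bdd_lipschitz_def by blast
  have "0 \<le> B" using B[of undefined] by linarith
  then show ?thesis
    using that[of B L] B L lipschitz_on_nonneg[OF L] lipschitz_onD[OF L]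
    by (auto simp: dist_real_def)
qed

lemma bdd_lipschitz_const: "bdd_lipschitz (\<lambda>z. c)"
  by (rule bdd_lipschitzI[where B="\<bar>c\<bar>" and L=0]) auto

lemma bdd_lipschitz_add:
  assumes "bdd_lipschitz f" "bdd_lipschitz g"
  shows "bdd_lipschitz (\<lambda>z. f z + g z)"
proof -
  obtain B L where f: "\<And>z. \<bar>f z\<bar> \<le> B" "\<And>y z. \<bar>f y - f z\<bar> \<le> L * dist y z"
    using bdd_lipschitzE[OF assms(1)] by metis
  obtain C K where g: "\<And>z. \<bar>g z\<bar> \<le> C" "\<And>y z. \<bar>g y - g z\<bar> \<le> K * dist y z"
    using bdd_lipschitzE[OF assms(2)] by metis
  show ?thesis
  proof (rule bdd_lipschitzI)
    fix y z
    show "\<bar>f z + g z\<bar> \<le> B + C" using f(1)[of z] g(1)[of z] by linarith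
    show "\<bar>f y + g y - (f z + g z)\<bar> \<le> (L + K) * dist y z"
      using f(2)[of y z] g(2)[of y z] by (simp add: distrib_right)
  qed
qed

lemma bdd_lipschitz_mult:
  assumes "bdd_lipschitz f" "bdd_lipschitz g"
  shows "bdd_lipschitz (\<lambda>z. f z * g z)"
proof -
  obtain B L where f: "0 \<le> B" "0 \<le> L" "\<And>z. \<bar>f z\<bar> \<le> B" "\<And>y z. \<bar>f y - f z\<bar> \<le> L * dist y z"
    using bdd_lipschitzE[OF assms(1)] by metis
  obtain C K where g: "0 \<le> C" "0 \<le> K" "\<And>z. \<bar>g z\<bar> \<le> C" "\<And>y z. \<bar>g y - g z\<bar> \<le> K * dist y z"
    using bdd_lipschitzE[OF assms(2)] by metis
  show ?thesis
  proof (rule bdd_lipschitzI)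
    fix y z
    show "\<bar>f z * g z\<bar> \<le> B * C" using f g by (simp add: abs_mult mult_mono)
    have "f y * g y - f z * g z = f y * (g y - g z) + (f y - f z) * g z"
      by (simp add: algebra_simps)
    then have "\<bar>f y * g y - f z * g z\<bar> \<le> \<bar>f y\<bar> * \<bar>g y - g z\<bar> + \<bar>f y - f z\<bar> * \<bar>g z\<bar>"
      by (metis abs_mult abs_triangle_ineq)
    also have "\<dots> \<le> B * (K * dist y z) + (L * dist y z) * C"
      using f g by (intro add_mono mult_mono) auto
    finally show "\<bar>f y * g y - f z * g z\<bar> \<le> (B * K + L * C) * dist y z"
      by (simp add: algebra_simps)
  qed
qed

lemma bdd_lipschitz_diff:
  assumes "bdd_lipschitz f" "bdd_lipschitz g"
  shows "bdd_lipschitz (\<lambda>z. f z - g z)"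
  using bdd_lipschitz_add[OF assms(1) bdd_lipschitz_mult[OF bdd_lipschitz_const[of "-1"] assms(2)]]
  by simp

lemma bdd_lipschitz_power:
  assumes "bdd_lipschitz f"
  shows "bdd_lipschitz (\<lambda>z. f z ^ j)"
proof (induction j)
  case 0
  then show ?case by (simp add: bdd_lipschitz_const)
next
  case (Suc j)
  then show ?case using bdd_lipschitz_mult[OF assms] by simp
qed

text \<open>Both \<open>1 + g y\<close> and \<open>1 + g z\<close> are at least 1, so taking
  reciprocals does not enlarge differences. All denominators to come have this shape.\<close>

lemma bdd_lipschitz_divide:
  assumes "bdd_lipschitz f" "bdd_lipschitz g" and nn: "\<And>z. 0 \<le> g z"
  shows "bdd_lipschitz (\<lambda>z. f z / (1 + g z))"
proof -
  obtain C K where g: "0 \<le> C" "0 \<le> K" "\<And>z. \<bar>g z\<bar> \<le> C" "\<And>y z. \<bar>g y - g z\<bar> \<le> K * dist y z"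
    using bdd_lipschitzE[OF assms(2)] by metis
  have "bdd_lipschitz (\<lambda>z. 1 / (1 + g z))"
  proof (rule bdd_lipschitzI)
    fix y z
    show "\<bar>1 / (1 + g z)\<bar> \<le> 1" using nn[of z] by simp
    have ge1: "1 \<le> (1 + g y) * (1 + g z)"
      using nn[of y] nn[of z] by (simp add: algebra_simps)
    have "1 / (1 + g y) - 1 / (1 + g z) = (g z - g y) / ((1 + g y) * (1 + g z))"
      using nn[of y] nn[of z] by (simp add: divide_simps)
    then have "\<bar>1 / (1 + g y) - 1 / (1 + g z)\<bar> = \<bar>g y - g z\<bar> / ((1 + g y) * (1 + g z))"
      using ge1 by (simp add: abs_minus_commute)
    also have "\<dots> \<le> \<bar>g y - g z\<bar> / 1"
      using ge1 by (intro divide_left_mono) auto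
    finally show "\<bar>1 / (1 + g y) - 1 / (1 + g z)\<bar> \<le> K * dist y z"
      using g(4)[of y z] by simp
  qed
  from bdd_lipschitz_mult[OF assms(1) this] show ?thesis by simp
qed

text \<open>Clamping every argument to a compact interval is what turns a rational field into a
  globally bounded and Lipschitz one.\<close>

lemma bdd_lipschitz_clamp:
  fixes g :: "'a::metric_space \<Rightarrow> real"
  assumes "\<And>y z. \<bar>g y - g z\<bar> \<le> dist y z" and "lo \<le> hi"
  shows "bdd_lipschitz (\<lambda>z. max lo (min hi (g z)))"
proof (rule bdd_lipschitzI)
  fix y z
  show "\<bar>max lo (min hi (g z))\<bar> \<le> \<bar>lo\<bar> + \<bar>hi\<bar>" using assms(2) by auto
  show "\<bar>max lo (min hi (g y)) - max lo (min hi (g z))\<bar> \<le> 1 * dist y z"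
    using assms(1)[of y z] by (auto simp: max_def min_def)
qed

lemmas bdd_lipschitz_intros =
  bdd_lipschitz_const bdd_lipschitz_add bdd_lipschitz_mult bdd_lipschitz_diff
  bdd_lipschitz_power bdd_lipschitz_divide

lemma bdd_lipschitz_continuous_on:
  assumes "bdd_lipschitz f"
  shows "continuous_on S f"
  using assms unfolding bdd_lipschitz_def
  by (meson lipschitz_on_continuous_on continuous_on_subset top_greatest)

text \<open>The weighted mean \<open>s\<^sup>-\<^sup>m \<integral>\<^sub>0\<^sup>s r\<^sup>m h(r) dr\<close> inverts the singular operator
  \<open>y' + m y / s\<close>; for \<open>m = 0\<close> it is the ordinary primitive, so that one fixed point theorem
  covers both the unstable manifold and the initial value problem.\<close>

definition wint :: "nat \<Rightarrow> (real \<Rightarrow> real) \<Rightarrow> real \<Rightarrow> real" where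
  "wint m h s = integral {0..s} (\<lambda>r. r ^ m * h r) / s ^ m"

lemma wint_integrable:
  assumes "continuous_on {0..} h"
  shows "(\<lambda>r::real. r ^ m * h r) integrable_on {0..s}"
proof (rule integrable_continuous_real)
  have "continuous_on {0..s} h" by (rule continuous_on_subset[OF assms]) auto
  then show "continuous_on {0..s} (\<lambda>r. r ^ m * h r)" by (intro continuous_intros)
qed

lemma wint_has_derivative:
  assumes "continuous_on {0..} h" "0 \<le> s"
  shows "((\<lambda>s. integral {0..s} (\<lambda>r. r ^ m * h r)) has_real_derivative s ^ m * h s) (at s within {0..})"
proof -
  have "continuous_on {0..s+1} h" by (rule continuous_on_subset[OF assms(1)]) auto
  then have "continuous_on {0..s+1} (\<lambda>r. r ^ m * h r)" by (intro continuous_intros)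
  then have "((\<lambda>s. integral {0..s} (\<lambda>r. r ^ m * h r)) has_real_derivative s ^ m * h s) (at s within {0..s+1})"
    by (rule integral_has_real_derivative) (use assms in auto)
  moreover have "at s within {0..s+1} = at s within {0..}"
    by (rule at_within_nhd[of s "{s-1<..<s+1}"]) (use assms in auto)
  ultimately show ?thesis by simp
qed

text \<open>The weight \<open>(r / s) ^ m\<close> is at most 1 on \<open>[0, s]\<close>, so the
  estimates for the singular operator are those of the ordinary primitive, uniformly in
  \<open>m\<close>.\<close>

lemma wint_abs_le:
  assumes "continuous_on {0..} h" "continuous_on {0..} e" "0 \<le> s"
    and "\<And>r. 0 \<le> r \<Longrightarrow> \<bar>h r\<bar> \<le> e r"
  shows "\<bar>wint m h s\<bar> \<le> integral {0..s} e"
proof (cases "s = 0")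
  case True
  then show ?thesis by (simp add: wint_def)
next
  case False
  then have s: "0 < s" using assms(3) by simp
  have ei: "e integrable_on {0..s}"
    using wint_integrable[OF assms(2), of 0 s] by simp
  have "norm (integral {0..s} (\<lambda>r. r ^ m * h r)) \<le> integral {0..s} (\<lambda>r. s ^ m * e r)"
  proof (rule integral_norm_bound_integral)
    fix r assume "r \<in> {0..s}"
    then show "norm (r ^ m * h r) \<le> s ^ m * e r"
      using assms(4)[of r] by (auto simp: abs_mult power_mono intro!: mult_mono)
  qed (use wint_integrable[OF assms(1)] ei in \<open>auto intro: integrable_on_mult_right\<close>)
  also have "\<dots> = s ^ m * integral {0..s} e" by simp
  finally show ?thesis using s by (simp add: wint_def divide_simps mult.commute)
qed

lemma wint_abs_le_linear:
  assumes "continuous_on {0..} h" "0 \<le> s" "\<And>r. 0 \<le> r \<Longrightarrow> \<bar>h r\<bar> \<le> B"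
  shows "\<bar>wint m h s\<bar> \<le> B * s"
  using wint_abs_le[OF assms(1) _ assms(2,3), of m] assms(2) by (simp add: mult.commute)

text \<open>Integrating \<open>exp (K * r)\<close> gains a factor \<open>1 / K\<close>. This gain is
  the source of the contraction on the whole half-line.\<close>

lemma wint_abs_le_exp:
  assumes "continuous_on {0..} h" "0 \<le> s" "0 < K" "0 \<le> C"
    and "\<And>r. 0 \<le> r \<Longrightarrow> \<bar>h r\<bar> \<le> C * exp (K * r)"
  shows "\<bar>wint m h s\<bar> \<le> C / K * exp (K * s)"
proof -
  have "((\<lambda>r. C * exp (K * r)) has_integral C / K * exp (K * s) - C / K * exp (K * 0)) {0..s}"
    by (rule fundamental_theorem_of_calculus)
      (use assms in \<open>auto intro!: derivative_eq_intros simp flip: has_real_derivative_iff_has_vector_derivative\<close>)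
  then have "integral {0..s} (\<lambda>r. C * exp (K * r)) = C / K * exp (K * s) - C / K"
    by (simp add: integral_unique del: integral_mult_right)
  moreover have "\<bar>wint m h s\<bar> \<le> integral {0..s} (\<lambda>r. C * exp (K * r))"
    by (rule wint_abs_le) (use assms in \<open>auto intro!: continuous_intros\<close>)
  moreover have "0 \<le> C / K" using assms by simp
  ultimately show ?thesis by linarith
qed

lemma wint_diff:
  assumes "continuous_on {0..} h" "continuous_on {0..} e"
  shows "wint m h s - wint m e s = wint m (\<lambda>r. h r - e r) s"
  unfolding wint_def right_diff_distrib
  using wint_integrable[OF assms(1), of m s] wint_integrable[OF assms(2), of m s]
  by (simp add: Henstock_Kurzweil_Integration.integral_diff diff_divide_distrib)

text \<open>Only \<open>s = 0\<close> is delicate, because of the division by \<open>s ^ m\<close>;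
  there the bound \<open>B * s\<close> forces the limit 0, which is the value of \<open>wint\<close>
  at 0.\<close>

lemma wint_continuous_on:
  assumes h: "continuous_on {0..} h" and B: "\<And>r. 0 \<le> r \<Longrightarrow> \<bar>h r\<bar> \<le> B"
  shows "continuous_on {0..} (wint m h)"
proof (rule continuous_onI)
  fix s e :: real assume s: "s \<in> {0..}" and e: "0 < e"
  show "\<exists>d>0. \<forall>x'\<in>{0..}. dist x' s < d \<longrightarrow> dist (wint m h x') (wint m h s) \<le> e"
  proof (cases "s = 0")
    case True
    have B0: "0 \<le> B" using B[of 0] by linarith
    have "\<bar>wint m h x\<bar> \<le> e" if "0 \<le> x" "x < e / (B + 1)" for x
    proof -
      have "\<bar>wint m h x\<bar> \<le> B * x" by (rule wint_abs_le_linear) (use that h B in auto)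
      also have "\<dots> \<le> (B + 1) * x" using that by (simp add: distrib_right)
      also have "\<dots> \<le> e" using that B0 by (simp add: pos_less_divide_eq mult.commute)
      finally show ?thesis .
    qed
    then show ?thesis
      using e B0 True by (intro exI[of _ "e / (B + 1)"]) (auto simp: dist_real_def wint_def)
  next
    case False
    then have s0: "0 < s" using s by simp
    have "continuous (at s within {0..}) (wint m h)"
      unfolding wint_def
      by (intro continuous_intros DERIV_continuous[OF wint_has_derivative[OF h]]) (use s0 in auto)
    then show ?thesis
      using e unfolding continuous_within_eps_delta by (meson less_imp_le)
  qed
qed

text \<open>Banach's fixed point theorem for bounded continuous functions, applied to
  \<open>exp (- K * s)\<close> times the unknown pair. The weight makes the possibly growing
  solution bounded and the operator contracting, so a single application covers \<open>{0..}\<close>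
  without continuation.\<close>

theorem volterra_solution:
  fixes f g :: "real \<times> real \<times> real \<Rightarrow> real" and a0 b0 :: real and m :: nat
  assumes f: "bdd_lipschitz f" and g: "bdd_lipschitz g"
  obtains a b :: "real \<Rightarrow> real"
  where "continuous_on {0..} a" "continuous_on {0..} b" "a 0 = a0" "b 0 = b0"
    "\<And>s. 0 \<le> s \<Longrightarrow> a s = a0 + wint 0 (\<lambda>r. f (r, a r, b r)) s"
    "\<And>s. 0 \<le> s \<Longrightarrow> b s = b0 + wint m (\<lambda>r. g (r, a r, b r)) s"
proof -
  obtain Bf Lf where fb: "0 \<le> Bf" "0 \<le> Lf" "\<And>z. \<bar>f z\<bar> \<le> Bf" "\<And>y z. \<bar>f y - f z\<bar> \<le> Lf * dist y z"
    using bdd_lipschitzE[OF f] by metis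
  obtain Bg Lg where gb: "0 \<le> Bg" "0 \<le> Lg" "\<And>z. \<bar>g z\<bar> \<le> Bg" "\<And>y z. \<bar>g y - g z\<bar> \<le> Lg * dist y z"
    using bdd_lipschitzE[OF g] by metis
  \<comment> \<open>The weighted operator has Lipschitz constant at most
    \<open>(Lf + Lg) / K\<close>, hence at most 1/2; the summand 1 keeps \<open>K\<close>
    positive.\<close>
  define K where "K = 2 * (Lf + Lg + 1)"
  have K: "0 < K" using fb gb by (simp add: K_def)
  define V :: "(real \<Rightarrow>\<^sub>C (real \<times> real)) \<Rightarrow> real \<Rightarrow> real \<times> real \<times> real"
    where "V u r = (r, exp (K * r) *\<^sub>R apply_bcontfun u r)" for u r
  \<comment> \<open>\<open>max 0 s\<close> extends the image to negative arguments by its value at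
    0, since the function space is over the whole line.\<close>
  define P :: "(real \<Rightarrow>\<^sub>C (real \<times> real)) \<Rightarrow> real \<Rightarrow> real \<times> real"
    where "P u s = (let s = max 0 s in exp (- K * s) *\<^sub>R
      (a0 + wint 0 (\<lambda>r. f (V u r)) s, b0 + wint m (\<lambda>r. g (V u r)) s))" for u s
  have Vc: "continuous_on S (V u)" for S u
    unfolding V_def by (intro continuous_intros continuous_on_apply_bcontfun)
  have fV: "continuous_on S (\<lambda>r. f (V u r))" for S u
    using continuous_on_compose[OF Vc bdd_lipschitz_continuous_on[OF f]] by (simp add: o_def)
  have gV: "continuous_on S (\<lambda>r. g (V u r))" for S u
    using continuous_on_compose[OF Vc bdd_lipschitz_continuous_on[OF g]] by (simp add: o_def)
  have pos: "continuous_on UNIV (\<lambda>s. F (max 0 s))" if "continuous_on {0..} F" for F :: "real \<Rightarrow> real"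
    by (rule continuous_on_compose2[OF that]) (auto intro!: continuous_intros)
  have Pcont: "continuous_on UNIV (P u)" for u
    unfolding P_def Let_def
    by (intro continuous_intros pos wint_continuous_on[OF fV fb(3)] wint_continuous_on[OF gV gb(3)])
  have one_le: "1 \<le> exp (K * r)" if "0 \<le> r" for r
    using K that by simp
  have Pbound: "norm (P u s) \<le> \<bar>a0\<bar> + Bf / K + (\<bar>b0\<bar> + Bg / K)" for u s
  proof -
    define t where "t = max 0 s"
    have t: "0 \<le> t" by (simp add: t_def)
    have "\<bar>wint 0 (\<lambda>r. f (V u r)) t\<bar> \<le> Bf / K * exp (K * t)"
      by (rule wint_abs_le_exp[OF fV t K fb(1)])
        (meson fb(1,3) mult_left_le one_le order_trans mult_le_cancel_left1 not_le)
    moreover have "\<bar>wint m (\<lambda>r. g (V u r)) t\<bar> \<le> Bg / K * exp (K * t)"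
      by (rule wint_abs_le_exp[OF gV t K gb(1)])
        (meson gb(1,3) mult_left_le one_le order_trans mult_le_cancel_left1 not_le)
    moreover have "exp (- K * t) * \<bar>c + w\<bar> \<le> \<bar>c\<bar> + C" if "\<bar>w\<bar> \<le> C * exp (K * t)" for c w C
    proof -
      have "exp (- K * t) * \<bar>c + w\<bar> \<le> exp (- K * t) * \<bar>c\<bar> + exp (- K * t) * \<bar>w\<bar>"
        by (simp flip: distrib_left)
      also have "\<dots> \<le> 1 * \<bar>c\<bar> + exp (- K * t) * (C * exp (K * t))"
        using that K t by (intro add_mono mult_right_mono mult_left_mono) auto
      also have "\<dots> = \<bar>c\<bar> + C" by (simp add: exp_minus field_simps)
      finally show ?thesis .
    qed
    ultimately have
      "exp (- K * t) * \<bar>a0 + wint 0 (\<lambda>r. f (V u r)) t\<bar> \<le> \<bar>a0\<bar> + Bf / K"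
      "exp (- K * t) * \<bar>b0 + wint m (\<lambda>r. g (V u r)) t\<bar> \<le> \<bar>b0\<bar> + Bg / K"
      by blast+
    moreover have "norm (P u s) \<le> exp (- K * t) * \<bar>a0 + wint 0 (\<lambda>r. f (V u r)) t\<bar>
        + exp (- K * t) * \<bar>b0 + wint m (\<lambda>r. g (V u r)) t\<bar>"
      unfolding P_def Let_def t_def[symmetric]
      by (rule order_trans[OF norm_scaleR[THEN eq_refl]])
        (simp add: norm_Pair_le[THEN order_trans] flip: distrib_left)
    ultimately show ?thesis by linarith
  qed
  have Pbc: "P u \<in> bcontfun" for u
    by (rule bcontfun_normI[OF Pcont Pbound])
  define \<Phi> where "\<Phi> u = Bcontfun (P u)" for u
  have ap: "apply_bcontfun (\<Phi> u) = P u" for u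
    by (simp add: \<Phi>_def Bcontfun_inverse Pbc)
  have contr: "dist (\<Phi> u) (\<Phi> v) \<le> 1/2 * dist u v" for u v
  proof (rule dist_bound)
    fix s :: real
    define t where "t = max 0 s"
    have t: "0 \<le> t" by (simp add: t_def)
    have dV: "dist (V u r) (V v r) \<le> exp (K * r) * dist u v" for r
      using dist_bounded[of u r v] by (simp add: V_def dist_Pair_Pair dist_norm flip: scaleR_diff_right)
    have w1: "\<bar>wint 0 (\<lambda>r. f (V u r)) t - wint 0 (\<lambda>r. f (V v r)) t\<bar> \<le> Lf * dist u v / K * exp (K * t)"
      unfolding wint_diff[OF fV fV]
    proof (rule wint_abs_le_exp[OF _ t K])
      fix r
      show "\<bar>f (V u r) - f (V v r)\<bar> \<le> Lf * dist u v * exp (K * r)"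
        using order_trans[OF fb(4)[of "V u r" "V v r"] mult_left_mono[OF dV[of r] fb(2)]]
        by (simp add: ac_simps)
    qed (use fb in \<open>auto intro!: continuous_intros fV\<close>)
    have w2: "\<bar>wint m (\<lambda>r. g (V u r)) t - wint m (\<lambda>r. g (V v r)) t\<bar> \<le> Lg * dist u v / K * exp (K * t)"
      unfolding wint_diff[OF gV gV]
    proof (rule wint_abs_le_exp[OF _ t K])
      fix r
      show "\<bar>g (V u r) - g (V v r)\<bar> \<le> Lg * dist u v * exp (K * r)"
        using order_trans[OF gb(4)[of "V u r" "V v r"] mult_left_mono[OF dV[of r] gb(2)]]
        by (simp add: ac_simps)
    qed (use gb in \<open>auto intro!: continuous_intros gV\<close>)
    have "dist (P u s) (P v s) = exp (- K * t) * norm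
        (wint 0 (\<lambda>r. f (V u r)) t - wint 0 (\<lambda>r. f (V v r)) t,
         wint m (\<lambda>r. g (V u r)) t - wint m (\<lambda>r. g (V v r)) t)"
      unfolding P_def Let_def t_def[symmetric] dist_norm
      by (simp flip: scaleR_diff_right del: scaleR_Pair)
    also have "\<dots> \<le> exp (- K * t) * (Lf * dist u v / K * exp (K * t) + Lg * dist u v / K * exp (K * t))"
      using w1 w2 by (intro mult_left_mono order_trans[OF norm_Pair_le] add_mono) auto
    also have "\<dots> = (Lf + Lg) / K * dist u v"
      using K by (simp add: exp_minus field_simps)
    also have "\<dots> \<le> 1/2 * dist u v"
      using fb gb by (intro mult_right_mono) (auto simp: K_def divide_simps)
    finally show "dist (apply_bcontfun (\<Phi> u) s) (apply_bcontfun (\<Phi> v) s) \<le> 1/2 * dist u v"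
      by (simp add: ap)
  qed
  have "\<exists>!u. \<Phi> u = u"
    by (rule banach_fix_type[where c="1/2"]) (use contr in auto)
  then obtain u where u: "\<Phi> u = u" by blast
  define v where "v r = exp (K * r) *\<^sub>R apply_bcontfun u r" for r
  have v: "v s = (a0 + wint 0 (\<lambda>r. f (V u r)) s, b0 + wint m (\<lambda>r. g (V u r)) s)" if "0 \<le> s" for s
  proof -
    have "apply_bcontfun u s = P u s" using ap[of u] u by simp
    then show ?thesis
      using that by (simp add: v_def P_def exp_minus)
  qed
  have Vv: "V u r = (r, fst (v r), snd (v r))" for r by (simp add: V_def v_def prod_eq_iff)
  show thesis
  proof (rule that[of "fst \<circ> v" "snd \<circ> v"])
    show "continuous_on {0..} (fst \<circ> v)" "continuous_on {0..} (snd \<circ> v)"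
      unfolding v_def o_def by (intro continuous_intros continuous_on_apply_bcontfun)+
    show "(fst \<circ> v) 0 = a0" "(snd \<circ> v) 0 = b0" by (simp_all add: v wint_def)
  qed (simp_all add: v Vv)
qed

section \<open>The unstable manifold of the origin\<close>

lemma wint_DERIV_0:
  assumes "continuous_on {0..} h" "0 \<le> s"
  shows "(wint 0 h has_real_derivative h s) (at s within {0..})"
  using wint_has_derivative[OF assms, of 0] by (simp add: wint_def[abs_def])

lemma wint_DERIV:
  assumes "continuous_on {0..} h" "0 < s"
  shows "(wint m h has_real_derivative h s - real m * wint m h s / s) (at s)"
proof -
  have "at s within {0..} = at s"
    by (rule at_within_interior) (use assms in \<open>simp add: interior_real_atLeast\<close>)
  then have d: "((\<lambda>s. integral {0..s} (\<lambda>r. r ^ m * h r)) has_real_derivative s ^ m * h s) (at s)"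
    using wint_has_derivative[OF assms(1), of s m] assms(2) by simp
  have "(wint m h has_real_derivative (s ^ m * h s * s ^ m - integral {0..s} (\<lambda>r. r ^ m * h r) * (real m * s ^ (m - 1))) / (s ^ m * s ^ m)) (at s)"
    unfolding wint_def[abs_def] using assms(2)
    by (auto intro!: derivative_eq_intros d)
  also have "(s ^ m * h s * s ^ m - integral {0..s} (\<lambda>r. r ^ m * h r) * (real m * s ^ (m - 1))) / (s ^ m * s ^ m)
      = h s - real m * wint m h s / s"
    using assms(2) by (cases m) (auto simp: wint_def divide_simps algebra_simps)
  finally show ?thesis .
qed

lemma bdd_lipschitz_clamp_coordinate:
  fixes lo hi :: real
  assumes "lo \<le> hi"
  shows "bdd_lipschitz (\<lambda>z::real\<times>real\<times>real. max lo (min hi (fst z)))"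
    "bdd_lipschitz (\<lambda>z::real\<times>real\<times>real. max lo (min hi (fst (snd z))))"
    "bdd_lipschitz (\<lambda>z::real\<times>real\<times>real. max lo (min hi (snd (snd z))))"
proof -
  have 1: "\<bar>fst y - fst z\<bar> \<le> dist y z" for y z :: "real \<times> real \<times> real"
    using dist_fst_le[of y z] by (simp add: dist_real_def)
  have 2: "\<bar>fst (snd y) - fst (snd z)\<bar> \<le> dist y z" for y z :: "real \<times> real \<times> real"
    using order_trans[OF dist_fst_le dist_snd_le, of y z] by (simp add: dist_real_def)
  have 3: "\<bar>snd (snd y) - snd (snd z)\<bar> \<le> dist y z" for y z :: "real \<times> real \<times> real"
    using order_trans[OF dist_snd_le dist_snd_le, of y z] by (simp add: dist_real_def)
  show "bdd_lipschitz (\<lambda>z::real\<times>real\<times>real. max lo (min hi (fst z)))"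
    "bdd_lipschitz (\<lambda>z::real\<times>real\<times>real. max lo (min hi (fst (snd z))))"
    "bdd_lipschitz (\<lambda>z::real\<times>real\<times>real. max lo (min hi (snd (snd z))))"
    using assms by (auto intro!: bdd_lipschitz_clamp 1 2 3)
qed

text \<open>For fixed \<open>x\<close> the factor next to \<open>1 + w\<^sup>2\<close> is affine in
  \<open>w\<close> with positive slope. Hence the sign of the field on a horizontal edge of a box is
  a condition on \<open>x\<close> alone, and division by \<open>1 + w\<^sup>2\<close> leaves the
  derivative of \<open>arctan w\<close>.\<close>

definition w_rhs :: "nat \<Rightarrow> real \<Rightarrow> real \<Rightarrow> real \<Rightarrow> real" where
  "w_rhs p lam x w =
     - (1 + w\<^sup>2) * ((real p + 1 + lam\<^sup>2 * x\<^sup>2) * w - real p * lam\<^sup>2 * x) / (1 + lam\<^sup>2 * x\<^sup>2)"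

lemma one_plus_square_pos: "0 < 1 + lam\<^sup>2 * (x::real)\<^sup>2"
  by (simp add: add_pos_nonneg)

lemma psi_rhs_eq_w_rhs: "psi_rhs (Suc p) p lam x (w - x) = w_rhs p lam x w - (w - x)"
proof -
  define D where "D = 1 + lam\<^sup>2 * x\<^sup>2"
  have "D \<noteq> 0" using one_plus_square_pos[of lam x] by (simp add: D_def)
  moreover have "lam\<^sup>2 * x\<^sup>2 = D - 1" by (simp add: D_def)
  ultimately show ?thesis
    unfolding psi_rhs_def w_rhs_def D_def[symmetric]
    by (simp add: divide_simps) (simp add: algebra_simps)
qed

text \<open>The field is odd, so nothing quadratic follows the linear part: a common factor
  \<open>S\<close> of both coordinates leaves a remainder of exactly \<open>S ^ 3\<close> times a
  function regular at \<open>S = 0\<close>.\<close>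

lemma w_rhs_scaled:
  fixes S A W lam q :: real and p :: nat
  assumes "real p * lam\<^sup>2 = q"
  shows "w_rhs p lam (S * A) (S * W) = - (real p + 1) * (S * W) + q * (S * A) +
     S ^ 3 * ((lam\<^sup>2 * A\<^sup>2 * (real p * W - q * A) - W\<^sup>2 * ((real p + 1) * W - q * A)
              - lam\<^sup>2 * S\<^sup>2 * A\<^sup>2 * W ^ 3) / (1 + lam\<^sup>2 * S\<^sup>2 * A\<^sup>2))"
proof -
  define D where "D = 1 + lam\<^sup>2 * S\<^sup>2 * A\<^sup>2"
  have D: "D \<noteq> 0" using one_plus_square_pos[of lam "S * A"]
    by (simp add: D_def power_mult_distrib mult.assoc)
  have D': "1 + lam\<^sup>2 * (S * A)\<^sup>2 = D" by (simp add: D_def power_mult_distrib mult.assoc)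
  have "- (1 + (S * W)\<^sup>2) * ((real p + 1 + lam\<^sup>2 * (S * A)\<^sup>2) * (S * W) - q * (S * A))
     = (- (real p + 1) * (S * W) + q * (S * A)) * D +
     S ^ 3 * (lam\<^sup>2 * A\<^sup>2 * (real p * W - q * A) - W\<^sup>2 * ((real p + 1) * W - q * A)
              - lam\<^sup>2 * S\<^sup>2 * A\<^sup>2 * W ^ 3)"
    unfolding D_def by (simp add: algebra_simps power2_eq_square power3_eq_cube)
  then show ?thesis
    unfolding w_rhs_def D' D_def[symmetric] assms using D by (simp add: field_simps)
qed

text \<open>In eigencoordinates \<open>(x, w) = s\<^sup>\<mu> (a + b, k a - (k + p) b)\<close> with \<open>s = e\<^sup>t\<close> the system
  becomes \<open>s a' = s\<^sup>2\<^sup>\<mu> R / m\<close>, \<open>s b' = - m b - s\<^sup>2\<^sup>\<mu> R / m\<close> with \<open>m = 2k + p\<close> the gap between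
  the eigenvalues, and \<open>R\<close> is smooth up to \<open>s = 0\<close>.  The solution with \<open>a = 1\<close>, \<open>b = 0\<close> at
  \<open>s = 0\<close> is the unstable manifold.\<close>

theorem unstable_orbit:
  fixes p k :: nat and lam :: real
  assumes k: "2 \<le> k" and lam: "real p * lam\<^sup>2 = real k * (real k + real p)"
  obtains x w :: "real \<Rightarrow> real" and t1 C :: real
  where "\<And>t. t < t1 \<Longrightarrow> (x has_real_derivative w t - x t) (at t)"
    "\<And>t. t < t1 \<Longrightarrow> (w has_real_derivative w_rhs p lam (x t) (w t)) (at t)"
    "\<And>t. t < t1 \<Longrightarrow> 0 < x t" "\<And>t. t < t1 \<Longrightarrow> x t < w t"
    "\<And>t. t < t1 \<Longrightarrow> \<bar>x t\<bar> \<le> C * exp ((real k - 1) * t)"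
    "\<And>t. t < t1 \<Longrightarrow> \<bar>w t\<bar> \<le> C * exp ((real k - 1) * t)"
proof -
  \<comment> \<open>The unstable eigenvalue; the stable one is \<open>- (k + p + 1)\<close>, whence
    the gap \<open>m\<close> below.\<close>
  define \<mu> where "\<mu> = k - 1"
  have \<mu>: "1 \<le> \<mu>" "k = \<mu> + 1" "real \<mu> = real k - 1" using k by (auto simp: \<mu>_def)
  define m where "m = 2 * k + p"
  have m: "0 < real m" using k by (simp add: m_def)
  define q where "q = real k * (real k + real p)"
  define W where "W a b = real k * a - (real k + real p) * b" for a b :: real
  define R where "R s a b = (lam\<^sup>2 * (a + b)\<^sup>2 * (real p * W a b - q * (a + b))
      - (W a b)\<^sup>2 * ((real p + 1) * W a b - q * (a + b)) - lam\<^sup>2 * (s ^ \<mu>)\<^sup>2 * (a + b)\<^sup>2 * W a b ^ 3)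
      / (1 + lam\<^sup>2 * (s ^ \<mu>)\<^sup>2 * (a + b)\<^sup>2)" for s a b :: real
  \<comment> \<open>Relative to \<open>s \<ge> 0\<close> this box is a neighbourhood of the starting
    values \<open>(0, 1, 0)\<close>, so the truncated equation is the true one for small
    \<open>s\<close>.\<close>
  define cl where "cl = (\<lambda>z::real\<times>real\<times>real.
      (max 0 (min 1 (fst z)), max 0 (min 2 (fst (snd z))), max (-1) (min 1 (snd (snd z)))))"
  have coord: "bdd_lipschitz (\<lambda>z. fst (cl z))" "bdd_lipschitz (\<lambda>z. fst (snd (cl z)))"
    "bdd_lipschitz (\<lambda>z. snd (snd (cl z)))"
    by (simp_all add: cl_def bdd_lipschitz_clamp_coordinate)
  \<comment> \<open>The exponent is lowered by one since \<open>d/ds\<close> is \<open>1 / s\<close>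
    times \<open>d/dt\<close>. As \<open>1 \<le> \<mu>\<close>, it is still nonnegative and
    \<open>f\<close> is regular at 0; the remaining singular term \<open>- m * b / s\<close> is
    absorbed by \<open>wint m\<close>.\<close>
  define f where "f z = fst (cl z) ^ (2 * \<mu> - 1) * R (fst (cl z)) (fst (snd (cl z))) (snd (snd (cl z))) * (1 / real m)" for z
  have f: "bdd_lipschitz f"
    unfolding f_def R_def W_def by (intro bdd_lipschitz_intros coord) auto
  obtain a b where cont: "continuous_on {0..} a" "continuous_on {0..} b" and init: "a 0 = 1" "b 0 = 0"
    and a: "\<And>s. 0 \<le> s \<Longrightarrow> a s = 1 + wint 0 (\<lambda>r. f (r, a r, b r)) s"
    and b: "\<And>s. 0 \<le> s \<Longrightarrow> b s = 0 + wint m (\<lambda>r. - 1 * f (r, a r, b r)) s"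
    by (rule volterra_solution[OF f bdd_lipschitz_mult[OF bdd_lipschitz_const[of "-1"] f], of 1 0 m]) (rule that)
  \<comment> \<open>\<open>w - x\<close> is \<open>s ^ \<mu>\<close> times
    \<open>\<mu> * a - (k + p + 1) * b\<close>. With \<open>1/2 < a\<close> the first term exceeds
    1/2, and this choice keeps the second below 1/2 in absolute value.\<close>
  define \<epsilon> where "\<epsilon> = 1 / (2 * (real k + real p + 1))"
  have \<epsilon>: "0 < \<epsilon>" "\<epsilon> \<le> 1/2" "(real k + real p + 1) * \<epsilon> = 1/2" by (auto simp: \<epsilon>_def divide_simps)
  have near0: "\<exists>d>0. \<forall>s. 0 \<le> s \<and> s < d \<longrightarrow> \<bar>F s - F 0\<bar> < e" if "continuous_on {0..} F" "0 < e" for F :: "real \<Rightarrow> real" and e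
  proof -
    have "\<exists>d>0. \<forall>s\<in>{0..}. dist s 0 < d \<longrightarrow> dist (F s) (F 0) < e"
      using continuous_on_iff[THEN iffD1, OF that(1), rule_format, of 0 e] that(2) by simp
    then show ?thesis by (force simp: dist_real_def)
  qed
  obtain d1 where d1: "0 < d1" "\<And>s. 0 \<le> s \<Longrightarrow> s < d1 \<Longrightarrow> \<bar>a s - 1\<bar> < 1/2"
    using near0[OF cont(1), of "1/2"] init by auto
  obtain d2 where d2: "0 < d2" "\<And>s. 0 \<le> s \<Longrightarrow> s < d2 \<Longrightarrow> \<bar>b s\<bar> < \<epsilon>"
    using near0[OF cont(2) \<epsilon>(1)] init by auto
  define s1 where "s1 = min 1 (min d1 d2)"
  have s1: "0 < s1" "s1 \<le> 1" "s1 \<le> d1" "s1 \<le> d2" using d1(1) d2(1) by (auto simp: s1_def)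
  have ab: "1/2 < a s" "a s < 3/2" "\<bar>b s\<bar> < \<epsilon>" if "0 \<le> s" "s < s1" for s
    using d1(2)[of s] d2(2)[of s] s1 that by (auto simp: abs_if split: if_splits)
  have fc: "continuous_on {0..} (\<lambda>r. f (r, a r, b r))"
    by (rule continuous_on_compose2[OF bdd_lipschitz_continuous_on[OF f, of UNIV]])
      (auto intro!: continuous_intros cont)
  have fR: "f (s, a s, b s) = s ^ (2 * \<mu> - 1) * R s (a s) (b s) / real m" if "0 \<le> s" "s < s1" for s
    using ab[OF that] that s1 \<epsilon> by (auto simp: f_def cl_def max_def min_def)
  have nhd: "at s within {0..} = at s" if "0 < s" for s :: real
    by (rule at_within_interior) (use that in \<open>simp add: interior_real_atLeast\<close>)
  have da: "(a has_real_derivative s ^ (2 * \<mu> - 1) * R s (a s) (b s) / real m) (at s)" if "0 < s" "s < s1" for s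
  proof -
    have "((\<lambda>s. 1 + wint 0 (\<lambda>r. f (r, a r, b r)) s) has_real_derivative f (s, a s, b s)) (at s)"
      using wint_DERIV_0[OF fc, of s] nhd that by (auto intro!: derivative_eq_intros)
    then have "(a has_real_derivative f (s, a s, b s)) (at s)"
      by (rule has_field_derivative_transform_within_open[where S="{0<..}"]) (use that a in auto)
    then show ?thesis using fR that by simp
  qed
  have db: "(b has_real_derivative - (s ^ (2 * \<mu> - 1) * R s (a s) (b s) / real m) - real m * b s / s) (at s)"
    if "0 < s" "s < s1" for s
  proof -
    have "(wint m (\<lambda>r. - 1 * f (r, a r, b r)) has_real_derivative
        - 1 * f (s, a s, b s) - real m * wint m (\<lambda>r. - 1 * f (r, a r, b r)) s / s) (at s)"
      by (rule wint_DERIV) (use that in \<open>auto intro!: continuous_intros fc\<close>)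
    then have "(b has_real_derivative - 1 * f (s, a s, b s) - real m * wint m (\<lambda>r. - 1 * f (r, a r, b r)) s / s) (at s)"
      by (rule has_field_derivative_transform_within_open[where S="{0<..}"]) (use that b in auto)
    moreover have "wint m (\<lambda>r. - 1 * f (r, a r, b r)) s = b s" using b[of s] that by simp
    ultimately show ?thesis using fR that by simp
  qed
  define X where "X s = s ^ \<mu> * (a s + b s)" for s
  define Y where "Y s = s ^ \<mu> * W (a s) (b s)" for s
  have sS: "s ^ (\<mu> - 1) = s ^ \<mu> / s" "s ^ (2 * \<mu> - 1) = (s ^ \<mu>)\<^sup>2 / s" if "0 < s" for s :: real
    using power_minus_mult[of \<mu> s] power_minus_mult[of "2 * \<mu>" s] \<mu>(1) that
    by (simp_all add: eq_divide_eq power_even_eq)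
  have dX: "(X has_real_derivative (Y s - X s) / s) (at s)" if s: "0 < s" "s < s1" for s
  proof -
    define F where "F = s ^ (2 * \<mu> - 1) * R s (a s) (b s) / real m"
    have "(X has_real_derivative real \<mu> * s ^ (\<mu> - 1) * (a s + b s)
        + s ^ \<mu> * (F + (- F - real m * b s / s))) (at s)"
      unfolding X_def using da[OF s] db[OF s]
      by (auto intro!: derivative_eq_intros simp: F_def algebra_simps)
    also have "real \<mu> * s ^ (\<mu> - 1) * (a s + b s) + s ^ \<mu> * (F + (- F - real m * b s / s))
        = s ^ \<mu> / s * (real \<mu> * (a s + b s) - real m * b s)"
      unfolding sS(1)[OF s(1)] using s by (simp add: field_simps)
    also have "\<dots> = (Y s - X s) / s"
      by (simp add: X_def Y_def W_def m_def \<mu>(3) algebra_simps add_divide_distrib diff_divide_distrib)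
    finally show ?thesis .
  qed
  have dY: "(Y has_real_derivative w_rhs p lam (X s) (Y s) / s) (at s)" if s: "0 < s" "s < s1" for s
  proof -
    define r where "r = R s (a s) (b s)"
    define F where "F = s ^ (2 * \<mu> - 1) * r / real m"
    have "(Y has_real_derivative real \<mu> * s ^ (\<mu> - 1) * W (a s) (b s)
        + s ^ \<mu> * (real k * F - (real k + real p) * (- F - real m * b s / s))) (at s)"
    proof -
      define G where "G = - F - real m * b s / s"
      have "(a has_real_derivative F) (at s)" "(b has_real_derivative G) (at s)"
        using da[OF s] db[OF s] by (simp_all add: F_def G_def r_def)
      then have "(Y has_real_derivative real \<mu> * s ^ (\<mu> - 1) * W (a s) (b s)
          + s ^ \<mu> * (real k * F - (real k + real p) * G)) (at s)"
        unfolding Y_def W_def by (auto intro!: derivative_eq_intros simp: algebra_simps)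
      then show ?thesis unfolding G_def .
    qed
    also have "real \<mu> * s ^ (\<mu> - 1) * W (a s) (b s)
        + s ^ \<mu> * (real k * F - (real k + real p) * (- F - real m * b s / s))
        = (s ^ \<mu> * (real \<mu> * W (a s) (b s) + (real k + real p) * real m * b s) + (s ^ \<mu>) ^ 3 * r) / s"
    proof -
      have mF: "(2 * real k + real p) * F = (s ^ \<mu>)\<^sup>2 / s * r"
        unfolding F_def sS(2)[OF s(1)] using m by (simp add: m_def)
      have "s ^ \<mu> * (real k * F - (real k + real p) * (- F - real m * b s / s))
          = s ^ \<mu> * ((2 * real k + real p) * F + (real k + real p) * real m * b s / s)"
        by (simp add: algebra_simps)
      then show ?thesis
        unfolding mF sS(1)[OF s(1)] using s by (simp add: field_simps power2_eq_square power3_eq_cube)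
    qed
    also have "\<dots> = (- (real p + 1) * (s ^ \<mu> * W (a s) (b s)) + q * (s ^ \<mu> * (a s + b s)) + (s ^ \<mu>) ^ 3 * r) / s"
      by (simp add: W_def q_def m_def \<mu>(3) algebra_simps power2_eq_square power3_eq_cube)
    also have "\<dots> = w_rhs p lam (X s) (Y s) / s"
      unfolding X_def Y_def r_def R_def w_rhs_scaled[OF lam[folded q_def]] by (rule refl)
    finally show ?thesis .
  qed
  have expln: "0 < exp t" "exp t < s1" if "t < ln s1" for t
    using exp_less_mono[OF that] s1(1) by simp_all
  have expmu: "exp t ^ \<mu> = exp ((real k - 1) * t)" for t
    using \<mu>(3) by (simp flip: exp_of_nat_mult)
  have bound: "\<bar>exp t ^ \<mu> * c\<bar> \<le> C * exp ((real k - 1) * t)" if "\<bar>c\<bar> \<le> C" for t c C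
    using that by (simp add: abs_mult expmu mult.commute)
  show thesis
  \<comment> \<open>A crude constant serving both coordinates: \<open>a + b\<close> is bounded by 2
    and \<open>W a b\<close> by \<open>2 * k + (k + p)\<close>.\<close>
  proof (rule that[of "ln s1" "\<lambda>t. X (exp t)" "\<lambda>t. Y (exp t)" "3 * real k + real p + 3"])
    fix t assume t: "t < ln s1"
    note e = expln[OF t]
    have ab': "1/2 < a (exp t)" "a (exp t) < 3/2" "\<bar>b (exp t)\<bar> < \<epsilon>" using ab[of "exp t"] e by auto
    show "((\<lambda>t. X (exp t)) has_real_derivative Y (exp t) - X (exp t)) (at t)"
      using DERIV_chain2[OF dX[OF e] DERIV_exp] by simp
    show "((\<lambda>t. Y (exp t)) has_real_derivative w_rhs p lam (X (exp t)) (Y (exp t))) (at t)"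
      using DERIV_chain2[OF dY[OF e] DERIV_exp] by simp
    show "0 < X (exp t)"
      using ab' \<epsilon> by (simp add: X_def)
    have "0 < real \<mu> * a (exp t) - (real k + real p + 1) * b (exp t)"
    proof -
      have "(real k + real p + 1) * b (exp t) < (real k + real p + 1) * \<epsilon>"
        using ab'(3) by (intro mult_strict_left_mono) auto
      moreover have "1 * (1/2) \<le> real \<mu> * a (exp t)"
        using ab'(1) \<mu>(1) by (intro mult_mono) auto
      ultimately show ?thesis using \<epsilon>(3) by simp
    qed
    then have "0 < exp t ^ \<mu> * (real \<mu> * a (exp t) - (real k + real p + 1) * b (exp t))" by simp
    also have "\<dots> = Y (exp t) - X (exp t)"
      by (simp add: X_def Y_def W_def \<mu>(3) algebra_simps)
    finally show "X (exp t) < Y (exp t)" by simp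
    have "\<bar>a (exp t) + b (exp t)\<bar> \<le> 3 * real k + real p + 3"
      using ab' \<epsilon> by auto
    then show "\<bar>X (exp t)\<bar> \<le> (3 * real k + real p + 3) * exp ((real k - 1) * t)"
      unfolding X_def by (rule bound)
    have "(real k + real p) * \<bar>b (exp t)\<bar> \<le> (real k + real p) * 1"
      using ab' \<epsilon> by (intro mult_left_mono) auto
    moreover have "real k * \<bar>a (exp t)\<bar> \<le> real k * 2"
      using ab' by (intro mult_left_mono) auto
    ultimately have "\<bar>W (a (exp t)) (b (exp t))\<bar> \<le> 3 * real k + real p + 3"
      unfolding W_def by (intro order_trans[OF abs_triangle_ineq4]) (simp add: abs_mult)
    then show "\<bar>Y (exp t)\<bar> \<le> (3 * real k + real p + 3) * exp ((real k - 1) * t)"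
      unfolding Y_def by (rule bound)
  qed
qed

section \<open>Continuation in an invariant box\<close>

text \<open>After the last time at which \<open>y\<close> is at most \<open>M\<close> the derivative
  is nonpositive, so the mean value theorem forbids a rise. The sign is required only strictly above
  \<open>M\<close>, where a clamped field takes its edge value; no strict inward inequality on the
  edge is involved.\<close>

lemma upper_barrier:
  fixes y y' :: "real \<Rightarrow> real"
  assumes d: "\<And>t. 0 \<le> t \<Longrightarrow> (y has_real_derivative y' t) (at t within {0..})"
    and init: "y 0 \<le> M" and barrier: "\<And>t. 0 \<le> t \<Longrightarrow> M < y t \<Longrightarrow> y' t \<le> 0"
    and "0 \<le> t"
  shows "y t \<le> M"
proof (rule ccontr)
  assume "\<not> y t \<le> M"
  then have yt: "M < y t" by simp
  have cont: "continuous_on {0..} y"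
    by (rule DERIV_continuous_on[where D=y']) (rule d, simp)
  define S where "S = {s\<in>{0..t}. y s \<in> {..M}}"
  have "closed ({0..t} \<inter> y -` {..M})"
    by (rule continuous_closed_preimage) (auto intro: continuous_on_subset[OF cont])
  moreover have "S = {0..t} \<inter> y -` {..M}" by (auto simp: S_def)
  ultimately have "closed S" by simp
  moreover have "0 \<in> S" using init \<open>0 \<le> t\<close> by (simp add: S_def)
  moreover have bdd: "bdd_above S" by (rule bdd_aboveI[of _ t]) (simp add: S_def)
  ultimately have s: "Sup S \<in> S" by (intro closed_contains_Sup) auto
  define s where "s = Sup S"
  have s': "0 \<le> s" "s \<le> t" "y s \<le> M" using s by (auto simp: S_def s_def)
  with yt have st: "s < t" by (metis leD le_less)
  have above: "M < y r" if "s < r" "r \<le> t" for r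
  proof (rule ccontr)
    assume "\<not> M < y r"
    then have "r \<in> S" using that s' by (simp add: S_def)
    then have "r \<le> s" unfolding s_def by (rule cSup_upper[OF _ bdd])
    then show False using that by simp
  qed
  have "\<exists>z>s. z < t \<and> y t - y s = (t - s) * y' z"
  proof (rule mvt_simple[OF st, of y "\<lambda>z h. h * y' z", simplified, folded conj_assoc, THEN bexE])
    fix z assume "s \<le> z" "z \<le> t"
    then have "(y has_real_derivative y' z) (at z within {s..t})"
      using d[of z] s' by (auto intro: DERIV_subset)
    then show "(y has_derivative (\<lambda>h. h * y' z)) (at z within {s..t})"
      by (simp add: has_field_derivative_def mult.commute[of _ "y' z"])
  qed auto
  then obtain z where z: "s < z" "z < t" "y t - y s = (t - s) * y' z" by blast
  have "y' z \<le> 0" using barrier above z s' by simp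
  then have "(t - s) * y' z \<le> 0" using st by (simp add: mult_nonneg_nonpos)
  then show False using z s' yt by linarith
qed

lemma lower_barrier:
  fixes y y' :: "real \<Rightarrow> real"
  assumes d: "\<And>t. 0 \<le> t \<Longrightarrow> (y has_real_derivative y' t) (at t within {0..})"
    and "c \<le> y 0" and "\<And>t. 0 \<le> t \<Longrightarrow> y t < c \<Longrightarrow> 0 \<le> y' t" and "0 \<le> t"
  shows "c \<le> y t"
  using upper_barrier[of "\<lambda>t. - y t" "\<lambda>t. - y' t" "- c" t] assms
  by (auto intro: DERIV_minus)

text \<open>The clamped field has a global solution. Beyond an edge it takes the value on that edge,
  which does not point outwards: for \<open>w\<close> this is \<open>lo\<close> and
  \<open>hi\<close>, for \<open>x\<close> it is immediate from \<open>x' = cl w - cl x\<close>. So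
  the solution stays in the box, where clamping changes nothing.\<close>

lemma box_initial_value_problem:
  fixes p :: nat and lam c M x0 w0 :: real
  assumes c: "0 < c" and x0: "c \<le> x0" "x0 \<le> M" and w0: "c \<le> w0" "w0 \<le> M"
    and lo: "\<And>x. c \<le> x \<Longrightarrow> x \<le> M \<Longrightarrow> (real p + 1 + lam\<^sup>2 * x\<^sup>2) * c \<le> real p * lam\<^sup>2 * x"
    and hi: "\<And>x. c \<le> x \<Longrightarrow> x \<le> M \<Longrightarrow> real p * lam\<^sup>2 * x \<le> (real p + 1 + lam\<^sup>2 * x\<^sup>2) * M"
  obtains x w :: "real \<Rightarrow> real"
  where "x 0 = x0" "w 0 = w0"
    "\<And>t. 0 \<le> t \<Longrightarrow> (x has_real_derivative w t - x t) (at t within {0..})"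
    "\<And>t. 0 \<le> t \<Longrightarrow> (w has_real_derivative w_rhs p lam (x t) (w t)) (at t within {0..})"
    "\<And>t. 0 \<le> t \<Longrightarrow> x t \<in> {c..M}" "\<And>t. 0 \<le> t \<Longrightarrow> w t \<in> {c..M}"
proof -
  have cM: "c \<le> M" using x0 by simp
  define cl where "cl v = max c (min M v)" for v
  have cl: "cl v \<in> {c..M}" "v \<in> {c..M} \<Longrightarrow> cl v = v" "M < v \<Longrightarrow> cl v = M" "v < c \<Longrightarrow> cl v = c" for v
    using cM by (auto simp: cl_def)
  define g where "g z = w_rhs p lam (cl (fst (snd z))) (cl (snd (snd z)))" for z :: "real \<times> real \<times> real"
  define f where "f z = cl (snd (snd z)) - cl (fst (snd z))" for z :: "real \<times> real \<times> real"
  have coord: "bdd_lipschitz (\<lambda>z::real\<times>real\<times>real. cl (fst (snd z)))"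
    "bdd_lipschitz (\<lambda>z::real\<times>real\<times>real. cl (snd (snd z)))"
    unfolding cl_def using bdd_lipschitz_clamp_coordinate[OF cM] by blast+
  have g_eq: "g = (\<lambda>z. (-1 * (1 + (cl (snd (snd z)))\<^sup>2) * ((real p + 1 + lam\<^sup>2 * (cl (fst (snd z)))\<^sup>2) * cl (snd (snd z))
      - real p * lam\<^sup>2 * cl (fst (snd z)))) / (1 + lam\<^sup>2 * (cl (fst (snd z)))\<^sup>2))"
    by (simp add: g_def w_rhs_def fun_eq_iff)
  have f: "bdd_lipschitz f" unfolding f_def by (intro bdd_lipschitz_intros coord)
  have g: "bdd_lipschitz g" unfolding g_eq by (intro bdd_lipschitz_intros coord) auto
  obtain x w where cont: "continuous_on {0..} x" "continuous_on {0..} w" and init: "x 0 = x0" "w 0 = w0"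
    and x: "\<And>s. 0 \<le> s \<Longrightarrow> x s = x0 + wint 0 (\<lambda>r. f (r, x r, w r)) s"
    and w: "\<And>s. 0 \<le> s \<Longrightarrow> w s = w0 + wint 0 (\<lambda>r. g (r, x r, w r)) s"
    by (rule volterra_solution[OF f g, of x0 w0 0]) (rule that)
  have d: "(y has_real_derivative h (t, x t, w t)) (at t within {0..})"
    if "0 \<le> t" "bdd_lipschitz h" "\<And>s. 0 \<le> s \<Longrightarrow> y s = y0 + wint 0 (\<lambda>r. h (r, x r, w r)) s" for y h y0 t
  proof -
    have "continuous_on {0..} (\<lambda>r. h (r, x r, w r))"
      by (rule continuous_on_compose2[OF bdd_lipschitz_continuous_on[OF that(2), of UNIV]])
        (auto intro!: continuous_intros cont)
    then have "((\<lambda>s. y0 + wint 0 (\<lambda>r. h (r, x r, w r)) s) has_real_derivative h (t, x t, w t)) (at t within {0..})"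
      using wint_DERIV_0 that(1) by (auto intro!: derivative_eq_intros)
    then show ?thesis
      by (rule has_field_derivative_transform_within[where d=1]) (use that in auto)
  qed
  have dw: "(w has_real_derivative w_rhs p lam (cl (x t)) (cl (w t))) (at t within {0..})" if "0 \<le> t" for t
    using d[OF that g w] by (simp add: g_def)
  have dx: "(x has_real_derivative cl (w t) - cl (x t)) (at t within {0..})" if "0 \<le> t" for t
    using d[OF that f x] by (simp add: f_def)
  have sgn: "w_rhs p lam y M \<le> 0" "0 \<le> w_rhs p lam y c" if "y \<in> {c..M}" for y
  proof -
    have neg: "- (1 + v\<^sup>2) \<le> 0" for v :: real using zero_le_power2[of v] by linarith
    show "w_rhs p lam y M \<le> 0"
      unfolding w_rhs_def using hi[of y] that one_plus_square_pos[of lam y]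
      by (intro divide_nonpos_pos mult_nonpos_nonneg neg) auto
    show "0 \<le> w_rhs p lam y c"
      unfolding w_rhs_def using lo[of y] that one_plus_square_pos[of lam y]
      by (intro divide_nonneg_pos mult_nonpos_nonpos neg) auto
  qed
  have wM: "w t \<in> {c..M}" if "0 \<le> t" for t
    using upper_barrier[OF dw, of M t] lower_barrier[OF dw, of c t] that init w0 cl sgn by auto
  have xM: "x t \<in> {c..M}" if "0 \<le> t" for t
    using upper_barrier[OF dx, of M t] lower_barrier[OF dx, of c t] that init x0 cl by auto
  show thesis
  proof (rule that[of x w])
    fix t :: real assume t: "0 \<le> t"
    show "(x has_real_derivative w t - x t) (at t within {0..})"
      using dx[OF t] cl(2)[OF wM[OF t]] cl(2)[OF xM[OF t]] by simp
    show "(w has_real_derivative w_rhs p lam (x t) (w t)) (at t within {0..})"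
      using dw[OF t] cl(2)[OF wM[OF t]] cl(2)[OF xM[OF t]] by simp
  qed (use init wM xM in auto)
qed

text \<open>Attaches a forward solution, known only on a half-line, to the piece coming from minus
  infinity. The one-sided slopes at \<open>t0\<close> agree because both pieces solve the same
  autonomous equation.\<close>

lemma has_real_derivative_glue:
  fixes f f' g g' :: "real \<Rightarrow> real"
  assumes f: "\<And>t. t \<le> t0 \<Longrightarrow> (f has_real_derivative f' t) (at t)"
    and g: "\<And>s. 0 \<le> s \<Longrightarrow> (g has_real_derivative g' s) (at s within {0..})"
    and "f t0 = g 0" "f' t0 = g' 0"
  shows "((\<lambda>t. if t \<le> t0 then f t else g (t - t0)) has_real_derivative
           (if t \<le> t0 then f' t else g' (t - t0))) (at t)"
    (is "(?h has_real_derivative _) _")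
proof -
  have gt: "((\<lambda>t. g (t - t0)) has_real_derivative g' (t - t0)) (at t within {t0..})" if "t0 \<le> t" for t
  proof -
    have "(g has_real_derivative g' (t - t0)) (at (t - t0) within (\<lambda>t. t - t0) ` {t0..})"
      by (rule DERIV_subset[OF g]) (use that in auto)
    moreover have "((\<lambda>t. t - t0) has_real_derivative 1) (at t within {t0..})"
      by (auto intro!: derivative_eq_intros)
    ultimately show ?thesis using DERIV_image_chain by (fastforce simp: o_def)
  qed
  consider "t < t0" | "t0 < t" | "t = t0" by linarith
  then show ?thesis
  proof cases
    case 1
    then show ?thesis
      using has_field_derivative_transform_within_open[OF f[of t], of "{..<t0}" ?h] by auto
  next
    case 2
    then have "at t within {t0..} = at t"
      by (intro at_within_interior) (simp add: interior_real_atLeast)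
    then show ?thesis
      using 2 has_field_derivative_transform_within_open[of "\<lambda>t. g (t - t0)" "g' (t - t0)" t "{t0<..}" ?h] gt[of t] by auto
  next
    case 3
    have "(?h has_real_derivative f' t0) (at t0 within {..t0})"
      by (rule has_field_derivative_transform_within[OF has_field_derivative_at_within[OF f[OF order_refl]], of 1]) auto
    moreover have "(?h has_real_derivative g' 0) (at t0 within {t0..})"
      by (rule has_field_derivative_transform_within[OF gt[of t0, simplified], of 1]) (use assms in auto)
    ultimately have "(?h has_real_derivative f' t0) (at t0 within ({..t0} \<union> {t0..}))"
      unfolding has_field_derivative_iff Lim_within_Un using assms(4) by simp
    moreover have "{..t0} \<union> {t0..} = UNIV" by auto
    ultimately show ?thesis using 3 by simp
  qed
qed

text \<open>The parameter \<open>M0\<close> lets a later argument demand a box large enough to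
  contain the equilibrium.\<close>

theorem global_orbit:
  fixes p k :: nat and lam M0 :: real
  assumes k: "2 \<le> k" and lam: "real p * lam\<^sup>2 = real k * (real k + real p)"
  obtains x w :: "real \<Rightarrow> real" and t0 c M C :: real
  where "\<And>t. (x has_real_derivative w t - x t) (at t)"
    "\<And>t. (w has_real_derivative w_rhs p lam (x t) (w t)) (at t)"
    "\<And>t. t \<le> t0 \<Longrightarrow> 0 < x t" "\<And>t. t \<le> t0 \<Longrightarrow> x t < w t"
    "\<And>t. t \<le> t0 \<Longrightarrow> \<bar>x t\<bar> \<le> C * exp ((real k - 1) * t)"
    "\<And>t. t \<le> t0 \<Longrightarrow> \<bar>w t\<bar> \<le> C * exp ((real k - 1) * t)"
    "\<And>t. t0 \<le> t \<Longrightarrow> x t \<in> {c..M}" "\<And>t. t0 \<le> t \<Longrightarrow> w t \<in> {c..M}" "0 < c" "M0 \<le> M"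
proof -
  obtain x1 w1 t1 C where
    dx1: "\<And>t. t < t1 \<Longrightarrow> (x1 has_real_derivative w1 t - x1 t) (at t)" and
    dw1: "\<And>t. t < t1 \<Longrightarrow> (w1 has_real_derivative w_rhs p lam (x1 t) (w1 t)) (at t)" and
    pos: "\<And>t. t < t1 \<Longrightarrow> 0 < x1 t" "\<And>t. t < t1 \<Longrightarrow> x1 t < w1 t" and
    bd: "\<And>t. t < t1 \<Longrightarrow> \<bar>x1 t\<bar> \<le> C * exp ((real k - 1) * t)"
    "\<And>t. t < t1 \<Longrightarrow> \<bar>w1 t\<bar> \<le> C * exp ((real k - 1) * t)"
    by (rule unstable_orbit[OF assms]) (rule that)
  \<comment> \<open>Strictly before \<open>t1\<close>, so that the early piece is differentiable
    from both sides at the gluing point.\<close>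
  define t0 where "t0 = t1 - 1"
  have t0: "t < t1" if "t \<le> t0" for t using that by (simp add: t0_def)
  \<comment> \<open>\<open>p * \<bar>lam\<bar>\<close> serves the top edge:
    \<open>2 * \<bar>lam\<bar> * x \<le> 1 + lam\<^sup>2 * x\<^sup>2\<close> bounds
    \<open>p * lam\<^sup>2 * x\<close> by \<open>M\<close> times the required factor. The other
    entries place the starting point in the box and keep \<open>M\<close> positive.\<close>
  define M where "M = max (max M0 (real p * \<bar>lam\<bar>)) (max (w1 t0) 1)"
  have M: "M0 \<le> M" "real p * \<bar>lam\<bar> \<le> M" "w1 t0 \<le> M" "1 \<le> M" "x1 t0 \<le> M"
    using pos(2)[OF t0, of t0] by (auto simp: M_def)
  have "0 < real p * lam\<^sup>2" unfolding lam using k by simp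
  then have lam0: "0 < lam\<^sup>2" by (metis mult_zero_right zero_le_power2 less_le)
  \<comment> \<open>\<open>c * lam\<^sup>2 * M \<le> 1\<close> serves the bottom edge: it bounds the
    quadratic term by \<open>x\<close>, the rest is at most \<open>(p + 1) * x\<close>, and
    \<open>p + 2 \<le> k * (k + p)\<close> closes the estimate.\<close>
  define c where "c = min (x1 t0) (1 / (lam\<^sup>2 * M))"
  have c: "0 < c" "c \<le> x1 t0" "c \<le> w1 t0" "c * (lam\<^sup>2 * M) \<le> 1"
  proof -
    have "0 < lam\<^sup>2 * M" using lam0 M(4) by simp
    moreover have "c \<le> 1 / (lam\<^sup>2 * M)" by (simp add: c_def)
    ultimately show "c * (lam\<^sup>2 * M) \<le> 1"
      using pos_le_divide_eq by blast
    show "0 < c" "c \<le> x1 t0" "c \<le> w1 t0"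
      using pos[OF t0, of t0] \<open>0 < lam\<^sup>2 * M\<close> by (auto simp: c_def)
  qed
  have lo: "(real p + 1 + lam\<^sup>2 * x\<^sup>2) * c \<le> real p * lam\<^sup>2 * x" if x: "c \<le> x" "x \<le> M" for x
  proof -
    have "0 \<le> lam\<^sup>2 * x * c" using x c by simp
    from mult_right_mono[OF x(2) this] have "lam\<^sup>2 * x\<^sup>2 * c \<le> c * (lam\<^sup>2 * M) * x"
      by (simp add: power2_eq_square mult_ac)
    also have "\<dots> \<le> 1 * x" using c x by (intro mult_right_mono) auto
    finally have 1: "lam\<^sup>2 * x\<^sup>2 * c \<le> x" by simp
    have 2: "(real p + 1) * c \<le> (real p + 1) * x" using x by (intro mult_left_mono) auto
    have "real p + 2 \<le> real k * (real k + real p)"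
    proof -
      have "real p + 2 \<le> real k + real p" using k by simp
      also have "\<dots> \<le> real k * (real k + real p)" using k by simp
      finally show ?thesis .
    qed
    then have "(real p + 2) * x \<le> real p * lam\<^sup>2 * x" unfolding lam using x c by (intro mult_right_mono) auto
    with 1 2 show ?thesis by (simp add: algebra_simps)
  qed
  have hi: "real p * lam\<^sup>2 * x \<le> (real p + 1 + lam\<^sup>2 * x\<^sup>2) * M" if x: "c \<le> x" "x \<le> M" for x
  proof -
    have "2 * (\<bar>lam\<bar> * x) \<le> 1 + lam\<^sup>2 * x\<^sup>2"
      using sum_squares_bound[of 1 "\<bar>lam\<bar> * x"] by (simp add: power_mult_distrib)
    moreover have "0 \<le> \<bar>lam\<bar> * x" using x c by simp
    ultimately have "\<bar>lam\<bar> * x \<le> real p + 1 + lam\<^sup>2 * x\<^sup>2" by linarith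
    then have "real p * \<bar>lam\<bar> * (\<bar>lam\<bar> * x) \<le> M * (real p + 1 + lam\<^sup>2 * x\<^sup>2)"
      using M(2,4) x c by (intro mult_mono) auto
    moreover have "real p * lam\<^sup>2 * x = real p * \<bar>lam\<bar> * (\<bar>lam\<bar> * x)"
      by (subst power2_abs[symmetric]) (simp only: power2_eq_square mult_ac)
    ultimately show ?thesis by (simp only: mult.commute[of _ M])
  qed
  obtain x2 w2 where init: "x2 0 = x1 t0" "w2 0 = w1 t0" and
    dx2: "\<And>t. 0 \<le> t \<Longrightarrow> (x2 has_real_derivative w2 t - x2 t) (at t within {0..})" and
    dw2: "\<And>t. 0 \<le> t \<Longrightarrow> (w2 has_real_derivative w_rhs p lam (x2 t) (w2 t)) (at t within {0..})" and
    box: "\<And>t. 0 \<le> t \<Longrightarrow> x2 t \<in> {c..M}" "\<And>t. 0 \<le> t \<Longrightarrow> w2 t \<in> {c..M}"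
    by (rule box_initial_value_problem[OF c(1,2) M(5) c(3) M(3)], erule (1) lo, erule (1) hi, rule that)
  define x where "x t = (if t \<le> t0 then x1 t else x2 (t - t0))" for t
  define w where "w t = (if t \<le> t0 then w1 t else w2 (t - t0))" for t
  have at0: "x t = x2 (t - t0)" "w t = w2 (t - t0)" if "t0 \<le> t" for t
    using that init by (auto simp: x_def w_def)
  show thesis
  proof (rule that[of x w t0 C c M])
    show "(x has_real_derivative w t - x t) (at t)" for t
      using has_real_derivative_glue[OF dx1[OF t0] dx2, of t0 t] init by (auto simp: x_def[abs_def] w_def)
    show "(w has_real_derivative w_rhs p lam (x t) (w t)) (at t)" for t
      using has_real_derivative_glue[OF dw1[OF t0] dw2, of t0 t] init by (auto simp: x_def w_def[abs_def])
  qed (use pos bd t0 box c M at0 in \<open>auto simp: x_def w_def\<close>)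
qed

section \<open>Underdamped oscillators\<close>

text \<open>Gronwall with the integrating factor \<open>exp (K * t)\<close>, used as a lower bound:
  a positive quantity cannot reach zero in finite time.\<close>

lemma exp_mult_deriv_mono:
  fixes \<rho> \<rho>' :: "real \<Rightarrow> real"
  assumes "a \<le> b" and "\<And>t. a \<le> t \<Longrightarrow> t \<le> b \<Longrightarrow> (\<rho> has_real_derivative \<rho>' t) (at t)"
    and "\<And>t. a \<le> t \<Longrightarrow> t \<le> b \<Longrightarrow> - K * \<rho> t \<le> \<rho>' t"
  shows "\<rho> a * exp (K * a) \<le> \<rho> b * exp (K * b)"
proof (rule DERIV_nonneg_imp_nondecreasing[OF assms(1)])
  fix t assume t: "a \<le> t" "t \<le> b"
  have "((\<lambda>t. \<rho> t * exp (K * t)) has_real_derivative (\<rho>' t + K * \<rho> t) * exp (K * t)) (at t)"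
    by (auto intro!: derivative_eq_intros assms(2) t simp: algebra_simps)
  moreover have "0 \<le> (\<rho>' t + K * \<rho> t) * exp (K * t)"
    using assms(3)[OF t] by simp
  ultimately show "\<exists>y. ((\<lambda>t. \<rho> t * exp (K * t)) has_real_derivative y) (at t) \<and> 0 \<le> y"
    by blast
qed

text \<open>If \<open>x\<close> had no late zero, the slope \<open>r = -y/x\<close> would solve the Riccati equation
  \<open>r' = r\<^sup>2 - P r + Q\<close>, whose right-hand side is eventually at least \<open>c (1 + r\<^sup>2)\<close> because its
  discriminant stays negative; then \<open>arctan r\<close> would be unbounded.\<close>

lemma damped_oscillator_zero:
  fixes x y P Q :: "real \<Rightarrow> real"
  assumes dx: "\<And>t. t0 \<le> t \<Longrightarrow> (x has_real_derivative y t) (at t)"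
    and dy: "\<And>t. t0 \<le> t \<Longrightarrow> (y has_real_derivative - P t * y t - Q t * x t) (at t)"
    and P: "(P \<longlongrightarrow> \<alpha>) at_top" and Q: "(Q \<longlongrightarrow> \<beta>) at_top" and disc: "\<alpha>\<^sup>2 < 4 * \<beta>"
  shows "\<exists>t>s. x t = 0"
proof (rule ccontr)
  assume "\<not> ?thesis"
  then have nz: "x t \<noteq> 0" if "s < t" for t using that by blast
  \<comment> \<open>Reserving \<open>c * (1 + r\<^sup>2)\<close> in the Riccati equation turns the
    discriminant condition into \<open>P\<^sup>2 < 4 * (1 - c) * (Q - c)\<close>. In the limit and
    at \<open>c = 0\<close> this is \<open>disc\<close>, so a small positive \<open>c\<close> is
    still allowed.\<close>
  have lim0: "((\<lambda>c. 4 * (1 - c) * (\<beta> - c) - \<alpha>\<^sup>2) \<longlongrightarrow> 4 * (1 - 0) * (\<beta> - 0) - \<alpha>\<^sup>2) (at_right 0)"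
    by (intro tendsto_intros)
  have "eventually (\<lambda>c. 4 * (1 - c) * (\<beta> - c) - \<alpha>\<^sup>2 > 0) (at_right (0::real))"
    by (rule order_tendstoD(1)[OF lim0]) (use disc in simp)
  moreover have "eventually (\<lambda>c. c \<in> {0<..<1}) (at_right (0::real))"
    by (rule eventually_at_right_real) simp
  ultimately have "eventually (\<lambda>c. c \<in> {0<..<1} \<and> 4 * (1 - c) * (\<beta> - c) - \<alpha>\<^sup>2 > 0) (at_right (0::real))"
    by eventually_elim simp
  then obtain c where c: "0 < c" "c < 1" "4 * (1 - c) * (\<beta> - c) - \<alpha>\<^sup>2 > 0"
    by (metis (no_types, lifting) eventually_happens' greaterThanLessThan_iff trivial_limit_at_right_real)
  have "((\<lambda>t. 4 * (1 - c) * (Q t - c) - (P t)\<^sup>2) \<longlongrightarrow> 4 * (1 - c) * (\<beta> - c) - \<alpha>\<^sup>2) at_top"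
    by (intro tendsto_intros P Q)
  then have "eventually (\<lambda>t. 4 * (1 - c) * (Q t - c) - (P t)\<^sup>2 > 0) at_top"
    using c(3) by (rule order_tendstoD(1))
  then obtain u0 where u0: "\<And>t. u0 \<le> t \<Longrightarrow> 4 * (1 - c) * (Q t - c) - (P t)\<^sup>2 > 0"
    unfolding eventually_at_top_linorder by blast
  define u where "u = max u0 (max t0 (s + 1))"
  have u: "u0 \<le> u" "t0 \<le> u" "s < u" by (auto simp: u_def)
  define r where "r t = - y t / x t" for t
  have dr: "(r has_real_derivative (r t)\<^sup>2 - P t * r t + Q t) (at t)" if "u \<le> t" for t
  proof -
    have t: "t0 \<le> t" "x t \<noteq> 0" using u that nz by auto
    have "(r has_real_derivative (- (- P t * y t - Q t * x t) * x t - - y t * y t) / (x t * x t)) (at t)"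
      unfolding r_def using t
      by (auto intro!: derivative_eq_intros dx dy simp: divide_simps) (simp add: algebra_simps)
    also have "(- (- P t * y t - Q t * x t) * x t - - y t * y t) / (x t * x t) = (r t)\<^sup>2 - P t * r t + Q t"
      unfolding r_def using t by (simp add: field_simps power2_eq_square)
    finally show ?thesis .
  qed
  have lower: "c * (1 + (r t)\<^sup>2) \<le> (r t)\<^sup>2 - P t * r t + Q t" if "u \<le> t" for t
  proof -
    have "4 * (1 - c) * ((1 - c) * (r t)\<^sup>2 - P t * r t + (Q t - c)) =
        (2 * (1 - c) * r t - P t)\<^sup>2 + (4 * (1 - c) * (Q t - c) - (P t)\<^sup>2)"
      by (simp add: algebra_simps power2_eq_square)
    also have "\<dots> > 0"
      using u0[of t] that u by (intro add_nonneg_pos) auto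
    finally have "0 < (1 - c) * (r t)\<^sup>2 - P t * r t + (Q t - c)"
      using c(2) by (simp add: zero_less_mult_iff)
    then show ?thesis by (simp add: algebra_simps)
  qed
  have grow: "c * (v - u) \<le> arctan (r v) - arctan (r u)" if "u \<le> v" for v
  proof -
    have "arctan (r u) - c * u \<le> arctan (r v) - c * v"
    proof (rule DERIV_nonneg_imp_nondecreasing[OF that])
      fix t assume t: "u \<le> t" "t \<le> v"
      have "((\<lambda>t. arctan (r t) - c * t) has_real_derivative
          inverse (1 + (r t)\<^sup>2) * ((r t)\<^sup>2 - P t * r t + Q t) - c) (at t)"
        by (auto intro!: derivative_eq_intros dr t)
      moreover have "0 \<le> inverse (1 + (r t)\<^sup>2) * ((r t)\<^sup>2 - P t * r t + Q t) - c"
        using lower[OF t(1)] by (simp add: field_simps add_pos_nonneg)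
      ultimately show "\<exists>y. ((\<lambda>t. arctan (r t) - c * t) has_real_derivative y) (at t) \<and> 0 \<le> y"
        by blast
    qed
    then show ?thesis by (simp add: algebra_simps)
  qed
  \<comment> \<open>By the time \<open>u + pi / c\<close> the arctangent would have risen by
    \<open>pi\<close>, the full width of its open range.\<close>
  have "c * (u + pi / c - u) \<le> arctan (r (u + pi / c)) - arctan (r u)"
    by (rule grow) (use c in simp)
  then have "pi \<le> arctan (r (u + pi / c)) - arctan (r u)" using c by simp
  moreover have "arctan (r (u + pi / c)) < pi / 2" "- (pi / 2) < arctan (r u)"
    by (rule arctan_ubound arctan_lbound)+
  ultimately show False by linarith
qed

text \<open>The squared distance to equilibrium decays at most exponentially.\<close>

lemma damped_oscillator_nonzero:
  fixes x y P Q :: "real \<Rightarrow> real"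
  assumes dx: "\<And>t. t0 \<le> t \<Longrightarrow> (x has_real_derivative y t) (at t)"
    and dy: "\<And>t. t0 \<le> t \<Longrightarrow> (y has_real_derivative - P t * y t - Q t * x t) (at t)"
    and P: "\<And>t. t0 \<le> t \<Longrightarrow> \<bar>P t\<bar> \<le> K" and Q: "\<And>t. t0 \<le> t \<Longrightarrow> \<bar>Q t\<bar> \<le> K"
    and "y t0 \<noteq> 0" "t0 \<le> t"
  shows "x t \<noteq> 0 \<or> y t \<noteq> 0"
proof -
  \<comment> \<open>The rate collects 1 from \<open>2 * x * y\<close>, \<open>2 * K\<close> from the
    damping term and \<open>K\<close> from the restoring term, using
    \<open>2 * \<bar>x * y\<bar> \<le> x\<^sup>2 + y\<^sup>2\<close>.\<close>
  have "((x t0)\<^sup>2 + (y t0)\<^sup>2) * exp ((3 * K + 1) * t0) \<le> ((x t)\<^sup>2 + (y t)\<^sup>2) * exp ((3 * K + 1) * t)"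
  proof (rule exp_mult_deriv_mono[OF assms(6)])
    fix s assume s: "t0 \<le> s" "s \<le> t"
    show "((\<lambda>t. (x t)\<^sup>2 + (y t)\<^sup>2) has_real_derivative
        2 * x s * y s + 2 * y s * (- P s * y s - Q s * x s)) (at s)"
      by (auto intro!: derivative_eq_intros dx dy s)
    have xy: "2 * \<bar>x s * y s\<bar> \<le> (x s)\<^sup>2 + (y s)\<^sup>2"
      using sum_squares_bound[of "\<bar>x s\<bar>" "\<bar>y s\<bar>"] by (simp add: abs_mult)
    have K: "0 \<le> K" using P[of t0] by linarith
    have "\<bar>2 * Q s * (x s * y s)\<bar> \<le> K * ((x s)\<^sup>2 + (y s)\<^sup>2)"
      using mult_mono[OF Q[OF s(1)] xy] K by (simp add: abs_mult)
    moreover have "\<bar>2 * P s * (y s)\<^sup>2\<bar> \<le> 2 * K * (y s)\<^sup>2"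
      using P[OF s(1)] by (simp add: abs_mult mult_right_mono)
    moreover have "2 * x s * y s + 2 * y s * (- P s * y s - Q s * x s)
        = 2 * (x s * y s) - 2 * P s * (y s)\<^sup>2 - 2 * Q s * (x s * y s)"
      by (simp add: algebra_simps power2_eq_square)
    moreover have "- (3 * K + 1) * ((x s)\<^sup>2 + (y s)\<^sup>2)
        = - (K * ((x s)\<^sup>2 + (y s)\<^sup>2)) - 2 * K * (x s)\<^sup>2 - 2 * K * (y s)\<^sup>2 - ((x s)\<^sup>2 + (y s)\<^sup>2)"
      by (simp add: algebra_simps)
    moreover have "0 \<le> K * (x s)\<^sup>2" using K by simp
    ultimately show "- (3 * K + 1) * ((x s)\<^sup>2 + (y s)\<^sup>2) \<le> 2 * x s * y s + 2 * y s * (- P s * y s - Q s * x s)"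
      using xy by linarith
  qed
  moreover have "0 < ((x t0)\<^sup>2 + (y t0)\<^sup>2) * exp ((3 * K + 1) * t0)"
    using assms(5) by (simp add: add_nonneg_pos)
  ultimately show ?thesis by auto
qed

lemma sign_constant:
  fixes y :: "real \<Rightarrow> real"
  assumes "connected S" "continuous_on S y" "\<And>t. t \<in> S \<Longrightarrow> y t \<noteq> 0" "u \<in> S" "v \<in> S" "0 < y u"
  shows "0 < y v"
proof (rule ccontr)
  assume "\<not> 0 < y v"
  then have "y v < 0" using assms(3,5) by force
  moreover have "connected (y ` S)" using assms(1,2) by (rule connected_continuous_image[rotated])
  ultimately have "0 \<in> y ` S"
    using assms(4-6) by (meson connected_contains_Icc imageI atLeastAtMost_iff less_imp_le subsetD)
  then show False using assms(3) by force
qed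

text \<open>Two late zeros of \<open>x\<close> enclose one of \<open>y\<close> by Rolle, so
  \<open>y\<close> has arbitrarily late zeros. At each of them \<open>y' = - Q * x\<close> is
  nonzero, because the orbit never reaches the equilibrium; hence the zeros are simple and isolated,
  \<open>y\<close> changes sign there, and they cannot accumulate at a finite time.
  \<open>T 0 = t0\<close> is only the starting time with \<open>y > 0\<close>; the zeros are
  numbered from 1, which fixes the parity of all signs.\<close>

theorem damped_oscillator_zero_sequence:
  fixes x y P Q :: "real \<Rightarrow> real"
  assumes dx: "\<And>t. t0 \<le> t \<Longrightarrow> (x has_real_derivative y t) (at t)"
    and dy: "\<And>t. t0 \<le> t \<Longrightarrow> (y has_real_derivative - P t * y t - Q t * x t) (at t)"
    and P: "\<And>t. t0 \<le> t \<Longrightarrow> \<bar>P t\<bar> \<le> K" and Q: "\<And>t. t0 \<le> t \<Longrightarrow> \<bar>Q t\<bar> \<le> K"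
    and Qpos: "\<And>t. t0 \<le> t \<Longrightarrow> 0 < Q t"
    and Plim: "(P \<longlongrightarrow> \<alpha>) at_top" and Qlim: "(Q \<longlongrightarrow> \<beta>) at_top" and disc: "\<alpha>\<^sup>2 < 4 * \<beta>"
    and xlim: "(x \<longlongrightarrow> 0) at_top" and y0: "0 < y t0"
  obtains T :: "nat \<Rightarrow> real"
  where "T 0 = t0" "strict_mono T" "filterlim T at_top sequentially"
    "\<And>i. 1 \<le> i \<Longrightarrow> y (T i) = 0"
    "\<And>i t. T i < t \<Longrightarrow> t < T (Suc i) \<Longrightarrow> 0 < (-1) ^ i * y t"
    "\<And>i. 1 \<le> i \<Longrightarrow> (-1) ^ i * x (T i) < 0"
proof -
  have ycont: "continuous_on {t0..} y"
    by (rule DERIV_continuous_on[where D="\<lambda>t. - P t * y t - Q t * x t"])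
      (rule dy[THEN has_field_derivative_at_within], simp)
  have nz: "x t \<noteq> 0" if "t0 \<le> t" "y t = 0" for t
    using damped_oscillator_nonzero[OF dx dy P Q _ that(1)] y0 that by auto
  have dyz: "(y has_real_derivative - Q t * x t) (at t)" if "t0 \<le> t" "y t = 0" for t
    using dy[OF that(1)] that(2) by simp
  have isolated: "\<exists>d>0. \<forall>s. 0 < \<bar>s - t\<bar> \<and> \<bar>s - t\<bar> < d \<longrightarrow> y s \<noteq> 0" if t: "t0 \<le> t" for t
  proof (cases "y t = 0")
    case True
    have "- Q t * x t \<noteq> 0" using nz[OF t True] Qpos[OF t] by simp
    moreover have "((\<lambda>s. (y s - y t) / (s - t)) \<longlongrightarrow> - Q t * x t) (at t)"
      using dyz[OF t True] by (simp add: has_field_derivative_iff)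
    ultimately have "eventually (\<lambda>s. (y s - y t) / (s - t) \<noteq> 0) (at t)"
      by (rule tendsto_imp_eventually_ne[rotated])
    then show ?thesis
      using True by (auto simp: eventually_at dist_real_def)
  next
    case False
    have "isCont y t" using dy[OF t] by (rule DERIV_isCont)
    then have "eventually (\<lambda>s. y s \<noteq> 0) (at t)"
      using False by (auto simp: isCont_def intro: tendsto_imp_eventually_ne)
    then show ?thesis by (auto simp: eventually_at dist_real_def)
  qed
  have ex: "\<exists>t>s. y t = 0" if s: "t0 \<le> s" for s
  proof (rule ccontr)
    assume no: "\<not> ?thesis"
    obtain z where z: "s < z" "x z = 0" 
      using damped_oscillator_zero[OF dx dy Plim Qlim disc, where s=s] by blast
    obtain z' where z': "z < z'" "x z' = 0" 
      using damped_oscillator_zero[OF dx dy Plim Qlim disc, where s=z] by blast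
    have "\<exists>l>z. l < z' \<and> y l = 0"
    proof -
      have xd: "(x has_real_derivative y l) (at l)" if "z \<le> l" for l
        using dx z s that by auto
      have "\<exists>l>z. l < z' \<and> (x has_real_derivative 0) (at l)"
      proof (rule Rolle[OF z'(1)])
        show "continuous_on {z..z'} x"
          by (rule DERIV_continuous_on[where D=y], rule xd[THEN has_field_derivative_at_within]) simp
        show "x differentiable (at l)" if "z < l" "l < z'" for l
          using xd[of l] that by (auto simp: real_differentiable_def)
      qed (use z z' in auto)
      then show ?thesis using dx DERIV_unique z s by (metis less_imp_le order_trans)
    qed
    then show False using no z by (meson less_trans)
  qed
  define next_zero where "next_zero s = Inf {t. s < t \<and> y t = 0}" for s
  have next_zero: "s < next_zero s \<and> y (next_zero s) = 0 \<and> (\<forall>t. s < t \<and> t < next_zero s \<longrightarrow> y t \<noteq> 0)"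
    if s: "t0 \<le> s" for s
  proof -
    let ?Z = "{t. s < t \<and> y t = 0}"
    obtain d where d: "0 < d" "\<And>u. 0 < \<bar>u - s\<bar> \<Longrightarrow> \<bar>u - s\<bar> < d \<Longrightarrow> y u \<noteq> 0"
      using isolated[OF s] by blast
    \<comment> \<open>The set is cut out by the strict inequality \<open>s < t\<close>. Isolation of
      \<open>s\<close> turns it into \<open>s + d \<le> t\<close>, which makes the set closed, so
      the infimum is attained.\<close>
    have Z: "?Z = {s + d..} \<inter> {t\<in>{t0..}. y t = 0}"
    proof -
      have "s + d \<le> t" if "s < t" "y t = 0" for t
        using d(2)[of t] that by force
      then show ?thesis using d(1) s by force
    qed
    have "closed {t\<in>{t0..}. y t = 0}"
      by (rule continuous_closed_preimage_constant[OF ycont]) simp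
    then have "closed ?Z" unfolding Z by (intro closed_Int closed_atLeast)
    moreover have "?Z \<noteq> {}" using ex[OF s] by auto
    moreover have "bdd_below ?Z" by (rule bdd_belowI[of _ s]) auto
    ultimately have "Inf ?Z \<in> ?Z" by (rule closed_contains_Inf[rotated 2])
    moreover have "y t \<noteq> 0" if "s < t" "t < Inf ?Z" for t
      using cInf_lower[OF _ \<open>bdd_below ?Z\<close>, of t] that by auto
    ultimately show ?thesis unfolding next_zero_def by blast
  qed
  define T where "T i = (next_zero ^^ i) t0" for i
  have T0: "T 0 = t0" and TS: "T (Suc i) = next_zero (T i)" for i by (simp_all add: T_def)
  have Tge: "t0 \<le> T i" for i
  proof (induction i)
    case (Suc i)
    then show ?case using next_zero[OF Suc.IH] TS[of i] by linarith
  qed (simp add: T0)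
  have mono: "strict_mono T"
    unfolding strict_mono_Suc_iff using next_zero[OF Tge] TS by simp
  have zero: "y (T i) = 0" if "1 \<le> i" for i
    using that next_zero[OF Tge] TS by (cases i) auto
  have between: "y t \<noteq> 0" if "T i < t" "t < T (Suc i)" for i t
    using that next_zero[OF Tge[of i]] TS[of i] by auto
  have conn: "0 < \<sigma> * y v" if "0 < \<sigma> * y u" "\<sigma> \<noteq> 0" "T i < u" "u < T (Suc i)" "T i < v" "v < T (Suc i)" for \<sigma> u v i
    by (rule sign_constant[of "{T i<..<T (Suc i)}" "\<lambda>t. \<sigma> * y t" u])
      (use that between Tge[of i] in \<open>auto intro!: continuous_intros continuous_on_subset[OF ycont]\<close>)
  have dsgn: "((\<lambda>t. \<sigma> * y t) has_real_derivative - Q (T i) * (\<sigma> * x (T i))) (at (T i))" if "1 \<le> i" for i \<sigma>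
    using DERIV_cmult[OF dyz[OF Tge zero[OF that]], of \<sigma>] by (simp add: mult_ac)
  have after: "0 < \<sigma> * y t" if "1 \<le> i" "\<sigma> * x (T i) < 0" "T i < t" "t < T (Suc i)" for i t \<sigma>
  proof -
    have "0 < - Q (T i) * (\<sigma> * x (T i))"
      using Qpos[OF Tge] that by (simp add: mult_pos_neg)
    note inc = DERIV_pos_inc_right[OF dsgn[OF that(1)] this]
    have "y (T i) = 0" using zero that(1) .
    with inc obtain d where d: "0 < d" "\<And>h. 0 < h \<Longrightarrow> h < d \<Longrightarrow> 0 < \<sigma> * y (T i + h)"
      by auto
    define h where "h = min (d / 2) ((t - T i) / 2)"
    have "0 < h" "h < d" "h < t - T i" using d(1) that by (auto simp: h_def min_def)
    then show ?thesis
      by (intro conn[OF d(2), of h]) (use that in auto)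
  qed
  have before: "\<sigma> * x (T (Suc i)) < 0" if "\<And>t. T i < t \<Longrightarrow> t < T (Suc i) \<Longrightarrow> \<sigma> * y t < 0" "\<sigma> \<noteq> 0" for i \<sigma>
  proof (rule ccontr)
    assume "\<not> \<sigma> * x (T (Suc i)) < 0"
    moreover have "x (T (Suc i)) \<noteq> 0" by (rule nz[OF Tge zero]) simp
    ultimately have "0 < \<sigma> * x (T (Suc i))"
      using that(2) by (simp add: not_less less_le)
    then have "- Q (T (Suc i)) * (\<sigma> * x (T (Suc i))) < 0"
      using Qpos[OF Tge[of "Suc i"]] by (simp add: mult_pos_pos)
    from DERIV_neg_dec_left[OF dsgn[of "Suc i" \<sigma>] this]
    obtain d where d: "0 < d" "\<And>h. 0 < h \<Longrightarrow> h < d \<Longrightarrow> 0 < \<sigma> * y (T (Suc i) - h)"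
      using zero[of "Suc i"] by auto
    define h where "h = min (d / 2) ((T (Suc i) - T i) / 2)"
    have "0 < h" "h < d" "h < T (Suc i) - T i"
      using d(1) strict_monoD[OF mono, of i "Suc i"] by (auto simp: h_def min_def)
    then show False using d(2)[of h] that(1)[of "T (Suc i) - h"] by auto
  qed
  \<comment> \<open>The induction carries two facts: the sign of \<open>y\<close> on an interval
    fixes the sign of \<open>x\<close> at its right end (\<open>before\<close>), and since
    \<open>y' = - Q * x\<close> there, that fixes the sign of \<open>y\<close> on the next interval
    (\<open>after\<close>).\<close>
  have sgn: "(\<forall>t. T i < t \<and> t < T (Suc i) \<longrightarrow> 0 < (-1) ^ i * y t) \<and> (-1) ^ Suc i * x (T (Suc i)) < 0" for i
  proof (induction i)
    case 0
    have pos: "0 < y t" if "T 0 < t" "t < T (Suc 0)" for t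
    proof (rule sign_constant[of "{t0..<T (Suc 0)}" y t0])
      show "y t \<noteq> 0" if "t \<in> {t0..<T (Suc 0)}" for t
        using that between[of 0 t] y0 T0 by (cases "t = t0") auto
    qed (use that T0 y0 in \<open>auto intro: continuous_on_subset[OF ycont]\<close>)
    moreover have "(-1) * x (T (Suc 0)) < 0"
      by (rule before) (use pos in auto)
    ultimately show ?case by simp
  next
    case (Suc i)
    have pos: "0 < (-1) ^ Suc i * y t" if "T (Suc i) < t" "t < T (Suc (Suc i))" for t
      by (rule after[OF _ _ that]) (use Suc in auto)
    moreover have "(-1) ^ Suc (Suc i) * x (T (Suc (Suc i))) < 0"
      by (rule before) (use pos in auto)
    ultimately show ?case by simp
  qed
  have "filterlim T at_top sequentially"
  proof (rule ccontr)
    assume notop: "\<not> ?thesis"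
    have "bdd_above (range T)"
    proof (rule ccontr)
      assume "\<not> bdd_above (range T)"
      then have "\<exists>N. Z \<le> T N" for Z
        by (metis bdd_aboveI2 linear)
      then have "filterlim T at_top sequentially"
        unfolding filterlim_at_top eventually_sequentially
        by (meson order_trans strict_mono_mono[OF mono] monoD)
      then show False using notop by blast
    qed
    then have lim: "T \<longlonglongrightarrow> Sup (range T)"
      using LIMSEQ_incseq_SUP[OF _ strict_mono_mono[OF mono]] by simp
    let ?S = "Sup (range T)"
    have lt: "T i < ?S" for i
      using strict_monoD[OF mono, of i "Suc i"] cSUP_upper[OF _ \<open>bdd_above (range T)\<close>, of "Suc i"] by auto
    obtain d where d: "0 < d" "\<And>u. 0 < \<bar>u - ?S\<bar> \<Longrightarrow> \<bar>u - ?S\<bar> < d \<Longrightarrow> y u \<noteq> 0"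
      using isolated[of ?S] lt[of 0] T0 by auto
    obtain N where "\<And>i. N \<le> i \<Longrightarrow> \<bar>T i - ?S\<bar> < d"
      using LIMSEQ_D[OF lim d(1)] by auto
    from this[of "Suc N"] show False using d(2)[of "T (Suc N)"] lt[of "Suc N"] zero[of "Suc N"] by auto
  qed
  moreover have "(-1) ^ i * x (T i) < 0" if "1 \<le> i" for i
    using sgn[of "i - 1"] that by simp
  ultimately show thesis
    using that[OF T0 mono _ zero] sgn by blast
qed

section \<open>The Lyapunov function\<close>

text \<open>A Barbalat argument. Once \<open>E\<close> is within \<open>\<eta>\<close> of its
  infimum, every later window of length \<open>\<tau>\<close> contains a point with
  \<open>\<bar>u\<bar> < \<epsilon> / 2\<close>, and the bound on \<open>u'\<close> carries this
  back to the start of the window at a cost of at most \<open>\<epsilon> / 2\<close>.\<close>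

lemma tendsto_zero_if_dissipated:
  fixes E E' u u' :: "real \<Rightarrow> real"
  assumes E: "\<And>t. t0 \<le> t \<Longrightarrow> (E has_real_derivative E' t) (at t)"
    and diss: "\<And>t. t0 \<le> t \<Longrightarrow> E' t \<le> - \<delta> * (u t)\<^sup>2" and \<delta>: "0 < \<delta>"
    and m: "\<And>t. t0 \<le> t \<Longrightarrow> m \<le> E t"
    and u: "\<And>t. t0 \<le> t \<Longrightarrow> (u has_real_derivative u' t) (at t)"
    and L: "\<And>t. t0 \<le> t \<Longrightarrow> \<bar>u' t\<bar> \<le> L"
  shows "(u \<longlongrightarrow> 0) at_top"
proof (rule tendstoI)
  fix \<epsilon> :: real assume \<epsilon>: "0 < \<epsilon>"
  have "0 \<le> L" using L[of t0] by auto
  define \<tau> where "\<tau> = \<epsilon> / (2 * (L + 1))"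
  have \<tau>: "0 < \<tau>" "L * \<tau> \<le> \<epsilon> / 2" using \<epsilon> \<open>0 \<le> L\<close> by (auto simp: \<tau>_def divide_simps)
  \<comment> \<open>The least loss of energy over a window of length \<open>\<tau>\<close> on which
    \<open>\<bar>u\<bar>\<close> is at least \<open>\<epsilon> / 2\<close>.\<close>
  define \<eta> where "\<eta> = \<delta> * \<tau> * (\<epsilon> / 2)\<^sup>2"
  have \<eta>: "0 < \<eta>" using \<delta> \<tau> \<epsilon> by (simp add: \<eta>_def)
  have bdd: "bdd_below (E ` {t0..})" by (rule bdd_belowI2[of _ m]) (use m in auto)
  have "\<exists>T\<in>{t0..}. E T < Inf (E ` {t0..}) + \<eta>"
    using cInf_lessD[of "E ` {t0..}" "Inf (E ` {t0..}) + \<eta>"] \<eta> by auto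
  then obtain T where T: "t0 \<le> T" "E T < Inf (E ` {t0..}) + \<eta>" by auto
  have dec: "E t \<le> E s" if "t0 \<le> s" "s \<le> t" for s t
  proof (rule DERIV_nonpos_imp_nonincreasing[OF that(2)])
    fix r assume r: "s \<le> r" "r \<le> t"
    have "0 \<le> \<delta> * (u r)\<^sup>2" using \<delta> by simp
    then have "E' r \<le> 0" using diss[of r] r that by simp
    then show "\<exists>y. (E has_real_derivative y) (at r) \<and> y \<le> 0" using E[of r] r that by auto
  qed
  have "\<bar>u t\<bar> < \<epsilon>" if "T \<le> t" for t
  proof -
    have t: "t0 \<le> t" using that T by simp
    obtain z where z: "t < z" "z < t + \<tau>" "E (t + \<tau>) - E t = \<tau> * E' z"
      using MVT2[of t "t + \<tau>" E E'] E t \<tau> by auto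
    have "E t < Inf (E ` {t0..}) + \<eta>" using dec[OF T(1) that] T by simp
    moreover have "Inf (E ` {t0..}) \<le> E (t + \<tau>)"
      by (rule cInf_lower[OF _ bdd]) (use t \<tau> in auto)
    ultimately have "- \<eta> < \<tau> * E' z" using z(3) by linarith
    also have "\<dots> \<le> \<tau> * (- \<delta> * (u z)\<^sup>2)" using diss[of z] z t \<tau> by (intro mult_left_mono) auto
    finally have "\<delta> * \<tau> * (u z)\<^sup>2 < \<delta> * \<tau> * (\<epsilon> / 2)\<^sup>2" by (simp add: \<eta>_def mult_ac)
    then have "(u z)\<^sup>2 < (\<epsilon> / 2)\<^sup>2" using \<delta> \<tau> by simp
    then have "\<bar>u z\<bar>\<^sup>2 < (\<epsilon> / 2)\<^sup>2" by (simp only: power2_abs)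
    then have uz: "\<bar>u z\<bar> < \<epsilon> / 2" by (rule power2_less_imp_less) (use \<epsilon> in simp)
    obtain y where y: "t < y" "y < z" "u z - u t = (z - t) * u' y"
      using MVT2[of t z u u'] u t z by auto
    have "\<bar>u z - u t\<bar> \<le> \<tau> * L"
      unfolding y(3) abs_mult using L[of y] y z t \<tau> by (intro mult_mono) auto
    then show ?thesis using uz \<tau>(2) by (simp add: mult.commute)
  qed
  then show "eventually (\<lambda>t. dist (u t) 0 < \<epsilon>) at_top"
    by (auto simp: eventually_at_top_linorder)
qed

text \<open>Energy dissipation controls only the distance of \<open>x\<close> from equilibrium; this
  recovers the velocity. A convergent \<open>u\<close> has a small difference quotient over a short
  window, and bounded \<open>u''\<close> transfers that to \<open>u'\<close> itself.\<close>

lemma derivative_tendsto_zero: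
  fixes u u' u'' :: "real \<Rightarrow> real"
  assumes u: "\<And>t. t0 \<le> t \<Longrightarrow> (u has_real_derivative u' t) (at t)"
    and u': "\<And>t. t0 \<le> t \<Longrightarrow> (u' has_real_derivative u'' t) (at t)"
    and L: "\<And>t. t0 \<le> t \<Longrightarrow> \<bar>u'' t\<bar> \<le> L" and lim: "(u \<longlongrightarrow> l) at_top"
  shows "(u' \<longlongrightarrow> 0) at_top"
proof (rule tendstoI)
  fix \<epsilon> :: real assume \<epsilon>: "0 < \<epsilon>"
  have "0 \<le> L" using L[of t0] by auto
  define \<tau> where "\<tau> = \<epsilon> / (2 * (L + 1))"
  have \<tau>: "0 < \<tau>" "L * \<tau> \<le> \<epsilon> / 2" using \<epsilon> \<open>0 \<le> L\<close> by (auto simp: \<tau>_def divide_simps)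
  have "eventually (\<lambda>t. dist (u t) l < \<tau> * \<epsilon> / 4) at_top"
    using tendstoD[OF lim, of "\<tau> * \<epsilon> / 4"] \<tau> \<epsilon> by simp
  then obtain T where T: "\<And>t. T \<le> t \<Longrightarrow> \<bar>u t - l\<bar> < \<tau> * \<epsilon> / 4"
    by (auto simp: eventually_at_top_linorder dist_real_def)
  have "\<bar>u' t\<bar> < \<epsilon>" if "max T t0 \<le> t" for t
  proof -
    have t: "t0 \<le> t" "T \<le> t" using that by auto
    obtain z where z: "t < z" "z < t + \<tau>" "u (t + \<tau>) - u t = \<tau> * u' z"
      using MVT2[of t "t + \<tau>" u u'] u t \<tau> by auto
    have "\<bar>\<tau> * u' z\<bar> < \<tau> * (\<epsilon> / 2)"
      unfolding z(3)[symmetric] using T[of t] T[of "t + \<tau>"] t \<tau> by (simp add: abs_if split: if_splits)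
    then have uz: "\<bar>u' z\<bar> < \<epsilon> / 2" using \<tau> by (simp add: abs_mult)
    obtain y where y: "t < y" "y < z" "u' z - u' t = (z - t) * u'' y"
      using MVT2[of t z u' u''] u' t z by auto
    have "\<bar>u' z - u' t\<bar> \<le> \<tau> * L"
      unfolding y(3) abs_mult using L[of y] y z t \<tau> by (intro mult_mono) auto
    then show ?thesis using uz \<tau>(2) by (simp add: mult.commute)
  qed
  then show "eventually (\<lambda>t. dist (u' t) 0 < \<epsilon>) at_top"
    by (auto simp: eventually_at_top_linorder intro: exI[of _ "max T t0"])
qed

text \<open>Separates friction, proportional to \<open>w - x\<close>, from a restoring force that
  depends on \<open>x\<close> alone and vanishes at \<open>0\<close> and at \<open>phi0\<close>. The
  hypothesis is the definition of \<open>phi0\<close> for \<open>n = p + 1\<close>, cleared of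
  denominators.\<close>

lemma w_rhs_split:
  assumes "lam\<^sup>2 * phi0\<^sup>2 = real p * lam\<^sup>2 - (real p + 1)"
  shows "w_rhs p lam x w = - (1 + w\<^sup>2) *
    ((real p + 1 + lam\<^sup>2 * x\<^sup>2) / (1 + lam\<^sup>2 * x\<^sup>2) * (w - x)
     + lam\<^sup>2 * x * (x\<^sup>2 - phi0\<^sup>2) / (1 + lam\<^sup>2 * x\<^sup>2))"
proof -
  have "(real p + 1 + lam\<^sup>2 * x\<^sup>2) * w - real p * lam\<^sup>2 * x
      = (real p + 1 + lam\<^sup>2 * x\<^sup>2) * (w - x) + lam\<^sup>2 * x * (x\<^sup>2 - phi0\<^sup>2)"
  proof -
    have "lam\<^sup>2 * x * phi0\<^sup>2 = (real p * lam\<^sup>2 - (real p + 1)) * x"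
      unfolding assms[symmetric] by (simp add: mult_ac)
    then show ?thesis by (simp add: algebra_simps power2_eq_square)
  qed
  moreover have "((a::real) * (w - x) + b) / (1 + lam\<^sup>2 * x\<^sup>2)
      = a / (1 + lam\<^sup>2 * x\<^sup>2) * (w - x) + b / (1 + lam\<^sup>2 * x\<^sup>2)" for a b
    by (simp add: add_divide_distrib)
  ultimately show ?thesis unfolding w_rhs_def by (metis times_divide_eq_right)
qed

text \<open>With \<open>\<Gamma>' = (p + 1 + \<lambda>\<^sup>2 x\<^sup>2) / (1 + \<lambda>\<^sup>2 x\<^sup>2)\<close> and \<open>d = arctan w + \<Gamma> x - \<Gamma> \<phi>\<^sub>0\<close> the system is
  of Lienard type: \<open>d' = - G x\<close>, where \<open>G\<close> has the sign of \<open>x - \<phi>\<^sub>0\<close>.  The energy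
  \<open>A x + B d\<close> with \<open>A' = G\<close> and \<open>B' = tan d - \<phi>\<^sub>0\<close> is dissipated because \<open>arctan w\<close> lies below
  \<open>d\<close> exactly when \<open>x > \<phi>\<^sub>0\<close>.  Clamping \<open>d\<close> to \<open>[0, arctan M]\<close> inside \<open>tan\<close> keeps \<open>B\<close> global and
  does not affect this comparison, since \<open>0 \<le> w \<le> M\<close>.\<close>

lemma lyapunov_consequences:
  fixes x w :: "real \<Rightarrow> real"
  assumes dx: "\<And>t. t0 \<le> t \<Longrightarrow> (x has_real_derivative w t - x t) (at t)"
    and dw: "\<And>t. t0 \<le> t \<Longrightarrow> (w has_real_derivative w_rhs p lam (x t) (w t)) (at t)"
    and xbox: "\<And>t. t0 \<le> t \<Longrightarrow> x t \<in> {c..M}" and wbox: "\<And>t. t0 \<le> t \<Longrightarrow> w t \<in> {c..M}" and c: "0 < c"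
    and lam: "0 < lam" and phi0: "0 < phi0" "phi0 \<le> M"
    and eq: "lam\<^sup>2 * phi0\<^sup>2 = real p * lam\<^sup>2 - (real p + 1)"
  shows "(x \<longlongrightarrow> phi0) at_top"
    and "\<And>s t. t0 \<le> s \<Longrightarrow> s < t \<Longrightarrow> w s = x s \<Longrightarrow> w t = x t \<Longrightarrow> phi0 < x s \<Longrightarrow> phi0 < x t \<Longrightarrow> x t < x s"
    and "\<And>s t. t0 \<le> s \<Longrightarrow> s < t \<Longrightarrow> w s = x s \<Longrightarrow> w t = x t \<Longrightarrow> x s < phi0 \<Longrightarrow> x t < phi0 \<Longrightarrow> x s < x t"
proof -
  define D where "D X = 1 + lam\<^sup>2 * X\<^sup>2" for X
  have D: "0 < D X" for X unfolding D_def by (rule one_plus_square_pos)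
  define g where "g X = (real p + 1 + lam\<^sup>2 * X\<^sup>2) / D X" for X
  have g: "0 < g X" for X
    unfolding g_def using D[of X] by (intro divide_pos_pos) (auto intro: add_pos_nonneg)
  define G where "G X = lam\<^sup>2 * X * (X\<^sup>2 - phi0\<^sup>2) / D X" for X
  \<comment> \<open>Obtained by integrating
    \<open>G X = X - (1 + lam\<^sup>2 * phi0\<^sup>2) * X / D X\<close>.\<close>
  define A where "A X = X\<^sup>2 / 2 - (1 + lam\<^sup>2 * phi0\<^sup>2) / (2 * lam\<^sup>2) * ln (D X)" for X
  define \<Gamma> where "\<Gamma> X = X + real p / lam * arctan (lam * X)" for X
  have dA: "(A has_real_derivative G X) (at X)" for X
  proof -
    have "(A has_real_derivative X - (1 + lam\<^sup>2 * phi0\<^sup>2) / (2 * lam\<^sup>2) * (lam\<^sup>2 * (2 * X) / D X)) (at X)"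
    proof -
      have "((\<lambda>X. X\<^sup>2 / 2 - b * ln (1 + a * X\<^sup>2)) has_real_derivative X - b * (a * (2 * X) / (1 + a * X\<^sup>2))) (at X)"
        if "0 < 1 + a * X\<^sup>2" for a b :: real
        using that by (auto intro!: derivative_eq_intros)
      then show ?thesis unfolding A_def D_def using D[of X, unfolded D_def] by blast
    qed
    also have "X - (1 + lam\<^sup>2 * phi0\<^sup>2) / (2 * lam\<^sup>2) * (lam\<^sup>2 * (2 * X) / D X) = G X"
      using lam D[of X] by (simp add: G_def divide_simps) (simp add: D_def algebra_simps power2_eq_square)
    finally show ?thesis .
  qed
  have d\<Gamma>: "(\<Gamma> has_real_derivative g X) (at X)" for X
  proof -
    have "(\<Gamma> has_real_derivative 1 + real p / lam * (inverse (1 + (lam * X)\<^sup>2) * lam)) (at X)"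
      unfolding \<Gamma>_def by (auto intro!: derivative_eq_intros)
    also have "1 + real p / lam * (inverse (1 + (lam * X)\<^sup>2) * lam) = g X"
      using lam D[of X] by (simp add: g_def D_def divide_simps power_mult_distrib)
    finally show ?thesis .
  qed
  have \<Gamma>mono: "\<Gamma> X \<le> \<Gamma> Y" if "X \<le> Y" for X Y
    by (rule DERIV_nonneg_imp_nondecreasing[OF that]) (use d\<Gamma> g less_imp_le in blast)
  define cl where "cl v = max 0 (min (arctan M) v)" for v
  have M: "0 < M" using phi0 by simp
  have cl: "0 \<le> cl v" "cl v \<le> arctan M" "- (pi / 2) < cl v" "cl v < pi / 2" for v
  proof -
    have am: "0 < arctan M" "arctan M < pi / 2" using M arctan_ubound[of M] by auto
    show *: "0 \<le> cl v" "cl v \<le> arctan M" using am(1) by (simp_all add: cl_def)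
    show "- (pi / 2) < cl v" "cl v < pi / 2" using * am by linarith+
  qed
  have cl_mono: "cl u \<le> cl v" if "u \<le> v" for u v using that by (auto simp: cl_def)
  have cl_id: "cl (arctan v) = arctan v" if "0 \<le> v" "v \<le> M" for v
    using that by (simp add: cl_def arctan_le_iff)
  define \<eta> where "\<eta> v = tan (cl v) - phi0" for v
  have \<eta>_mono: "\<eta> u \<le> \<eta> v" if "u \<le> v" for u v
    unfolding \<eta>_def using cl_mono[OF that] cl by (auto intro!: tan_mono_le)
  have \<eta>_arctan: "\<eta> (arctan v) = v - phi0" if "0 \<le> v" "v \<le> M" for v
    by (simp add: \<eta>_def cl_id that tan_arctan)
  have \<eta>cont: "isCont \<eta> v" for v
  proof -
    have "cos (cl v) \<noteq> 0" using cos_gt_zero_pi cl by (metis less_irrefl)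
    moreover have "isCont cl v" unfolding cl_def by (intro continuous_intros)
    ultimately show ?thesis unfolding \<eta>_def by (intro continuous_intros isCont_tan')
  qed
  \<comment> \<open>Existence of a primitive of the continuous function \<open>\<eta>\<close>
    suffices: its monotonicity on either side of \<open>\<theta>\<close> follows from the sign of
    \<open>\<eta>\<close>, without a closed form.\<close>
  have "\<exists>B. \<forall>v. (-\<infinity>::ereal) < v \<longrightarrow> v < (\<infinity>::ereal) \<longrightarrow> (B has_vector_derivative \<eta> v) (at v)"
    by (rule einterval_antiderivative) (use \<eta>cont in auto)
  then obtain B where dB: "\<And>v. (B has_real_derivative \<eta> v) (at v)"
    by (auto simp: has_real_derivative_iff_has_vector_derivative)
  define \<theta> where "\<theta> = arctan phi0"
  have \<eta>\<theta>: "\<eta> \<theta> = 0" using \<eta>_arctan[of phi0] phi0 by (simp add: \<theta>_def)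
  have B_inc: "B u \<le> B v" if "\<theta> \<le> u" "u \<le> v" for u v
    by (rule DERIV_nonneg_imp_nondecreasing[OF that(2)])
      (use dB \<eta>_mono \<eta>\<theta> that in \<open>metis order_trans\<close>)
  have B_dec: "B v \<le> B u" if "v \<le> \<theta>" "u \<le> v" for u v
    by (rule DERIV_nonpos_imp_nonincreasing[OF that(2)])
      (use dB \<eta>_mono \<eta>\<theta> that in \<open>metis order_trans\<close>)
  have G_factor: "G X * (X - phi0) = lam\<^sup>2 * X * (X + phi0) / D X * (X - phi0)\<^sup>2" for X
    by (simp add: G_def power2_eq_square algebra_simps)
  have G_pos: "0 \<le> G X" if "phi0 \<le> X" for X
    unfolding G_def using that phi0 D[of X] by (auto intro!: divide_nonneg_pos mult_nonneg_nonneg power_mono)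
  have G_neg: "G X \<le> 0" if "0 \<le> X" "X \<le> phi0" for X
    unfolding G_def using that phi0 D[of X] by (auto intro!: divide_nonpos_pos mult_nonneg_nonpos power_mono)
  have A_inc: "A X \<le> A Y" if "phi0 \<le> X" "X \<le> Y" for X Y
    by (rule DERIV_nonneg_imp_nondecreasing[OF that(2)]) (use dA G_pos that in \<open>metis order_trans\<close>)
  have A_dec: "A Y \<le> A X" if "0 \<le> X" "X \<le> Y" "Y \<le> phi0" for X Y
    by (rule DERIV_nonpos_imp_nonincreasing[OF that(2)]) (use dA G_neg that in \<open>metis order_trans\<close>)
  define d where "d t = arctan (w t) + \<Gamma> (x t) - \<Gamma> phi0" for t
  define E where "E t = A (x t) + B (d t)" for t
  define E' where "E' t = G (x t) * (w t - x t - \<eta> (d t))" for t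
  have dd: "(d has_real_derivative - G (x t)) (at t)" if t: "t0 \<le> t" for t
  proof -
    have "(d has_real_derivative inverse (1 + (w t)\<^sup>2) * w_rhs p lam (x t) (w t) + g (x t) * (w t - x t)) (at t)"
      unfolding d_def
      by (auto intro!: derivative_eq_intros dw[OF t] DERIV_chain2[OF d\<Gamma> dx[OF t]])
    also have "inverse (1 + (w t)\<^sup>2) * w_rhs p lam (x t) (w t) = - (g (x t) * (w t - x t) + G (x t))"
      unfolding w_rhs_split[OF eq] D_def[symmetric] g_def[symmetric] G_def[symmetric]
      using one_plus_square_pos[of 1 "w t"] by (simp add: field_simps)
    finally show ?thesis by simp
  qed
  have dE: "(E has_real_derivative E' t) (at t)" if t: "t0 \<le> t" for t
    unfolding E_def E'_def
    using DERIV_add[OF DERIV_chain2[OF dA dx[OF t]] DERIV_chain2[OF dB dd[OF t]]]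
    by (simp add: algebra_simps)
  \<comment> \<open>A lower bound on the box for the quotient of \<open>G X\<close> by
    \<open>X - phi0\<close>, which is \<open>lam\<^sup>2 * X * (X + phi0) / D X\<close>: use
    \<open>c \<le> X\<close> and \<open>phi0 \<le> X + phi0\<close> above, and
    \<open>D X \<le> D M\<close> below.\<close>
  define \<delta> where "\<delta> = lam\<^sup>2 * c * phi0 / D M"
  have \<delta>: "0 < \<delta>" unfolding \<delta>_def using lam c phi0 D by simp
  have diss: "E' t \<le> - \<delta> * (x t - phi0)\<^sup>2" if t: "t0 \<le> t" for t
  proof -
    have X: "0 < x t" "c \<le> x t" "x t \<le> M" and W: "0 \<le> w t" "w t \<le> M"
      using xbox[OF t] wbox[OF t] c by auto
    have "E' t \<le> - (G (x t) * (x t - phi0))"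
    proof (cases "phi0 \<le> x t")
      case True
      then have "arctan (w t) \<le> d t" using \<Gamma>mono by (simp add: d_def)
      then have "w t - phi0 \<le> \<eta> (d t)" using \<eta>_mono \<eta>_arctan[OF W] by metis
      then have "G (x t) * (w t - x t - \<eta> (d t)) \<le> G (x t) * (phi0 - x t)"
        using G_pos[OF True] by (intro mult_left_mono) auto
      then show ?thesis by (simp add: E'_def algebra_simps)
    next
      case False
      then have "d t \<le> arctan (w t)" using \<Gamma>mono[of "x t" phi0] by (simp add: d_def)
      then have "\<eta> (d t) \<le> w t - phi0" using \<eta>_mono \<eta>_arctan[OF W] by metis
      then have "G (x t) * (w t - x t - \<eta> (d t)) \<le> G (x t) * (phi0 - x t)"
        using G_neg[of "x t"] False X by (intro mult_left_mono_neg) auto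
      then show ?thesis by (simp add: E'_def algebra_simps)
    qed
    moreover have "\<delta> * (x t - phi0)\<^sup>2 \<le> G (x t) * (x t - phi0)"
    proof -
      have "D (x t) \<le> D M" unfolding D_def using X by (auto intro!: mult_left_mono power_mono)
      moreover have "c * phi0 \<le> x t * (x t + phi0)" using X c phi0 by (intro mult_mono) auto
      ultimately have "\<delta> \<le> lam\<^sup>2 * x t * (x t + phi0) / D (x t)"
        unfolding \<delta>_def using D[of "x t"] X phi0 c by (intro frac_le) (auto simp: mult.assoc intro: mult_left_mono)
      then show ?thesis unfolding G_factor by (intro mult_right_mono) auto
    qed
    ultimately show ?thesis by simp
  qed
  have E_bound: "A phi0 + B \<theta> \<le> E t" if t: "t0 \<le> t" for t
  proof -
    have "A phi0 \<le> A (x t)"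
      using A_inc[of phi0 "x t"] A_dec[of "x t" phi0] xbox[OF t] c by (cases "phi0 \<le> x t") auto
    moreover have "B \<theta> \<le> B (d t)"
      using B_inc[of \<theta> "d t"] B_dec[of \<theta> "d t"] by (cases "\<theta> \<le> d t") auto
    ultimately show ?thesis by (simp add: E_def)
  qed
  have "((\<lambda>t. x t - phi0) \<longlongrightarrow> 0) at_top"
  proof (rule tendsto_zero_if_dissipated[OF dE diss \<delta> E_bound])
    fix t assume t: "t0 \<le> t"
    show "((\<lambda>t. x t - phi0) has_real_derivative w t - x t) (at t)"
      using dx[OF t] by (auto intro!: derivative_eq_intros)
    show "\<bar>w t - x t\<bar> \<le> M" using xbox[OF t] wbox[OF t] c by auto
  qed
  then show "(x \<longlongrightarrow> phi0) at_top" by (rule LIM_zero_cancel)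
  have E_dec: "E t \<le> E s" if "t0 \<le> s" "s \<le> t" for s t
  proof (rule DERIV_nonpos_imp_nonincreasing[OF that(2)])
    fix r assume r: "s \<le> r" "r \<le> t"
    have "0 \<le> \<delta> * (x r - phi0)\<^sup>2" using \<delta> by simp
    then have "E' r \<le> 0" using diss[of r] r that by simp
    then show "\<exists>y. (E has_real_derivative y) (at r) \<and> y \<le> 0" using dE[of r] r that by auto
  qed
  \<comment> \<open>Strictness comes from the starting point alone: \<open>E\<close> drops just
    after \<open>s\<close> and never rises again.\<close>
  have E_strict: "E t < E s" if st: "t0 \<le> s" "s < t" "x s \<noteq> phi0" for s t
  proof -
    have "0 < \<delta> * (x s - phi0)\<^sup>2" using \<delta> st by simp
    then have "E' s < 0" using diss[OF st(1)] by simp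
    from DERIV_neg_dec_right[OF dE[OF st(1)] this]
    obtain e where e: "0 < e" "\<And>h. 0 < h \<Longrightarrow> h < e \<Longrightarrow> E (s + h) < E s" by auto
    define h where "h = min (e / 2) (t - s)"
    have "0 < h" "h < e" "s + h \<le> t" using e st by (auto simp: h_def min_def)
    then show ?thesis using e(2)[of h] E_dec[of "s + h" t] st by simp
  qed
  \<comment> \<open>The energy on the line \<open>w = x\<close>. The argument of \<open>B\<close> is
    increasing in \<open>X\<close> and equals \<open>\<theta>\<close> at \<open>phi0\<close>, so
    both summands are monotone away from \<open>phi0\<close>.\<close>
  define V where "V X = A X + B (arctan X + \<Gamma> X - \<Gamma> phi0)" for X
  have E_V: "E t = V (x t)" if "w t = x t" for t
    using that by (simp add: E_def V_def d_def)
  have V_inc: "V X \<le> V Y" if "phi0 \<le> X" "X \<le> Y" for X Y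
  proof -
    have "arctan phi0 \<le> arctan X" "arctan X \<le> arctan Y" using that by (simp_all add: arctan_le_iff)
    then show ?thesis
      unfolding V_def using that \<Gamma>mono[of phi0 X] \<Gamma>mono[of X Y]
      by (intro add_mono A_inc B_inc) (auto simp: \<theta>_def)
  qed
  have V_dec: "V Y \<le> V X" if "0 \<le> X" "X \<le> Y" "Y \<le> phi0" for X Y
  proof -
    have "arctan X \<le> arctan Y" "arctan Y \<le> arctan phi0" using that by (simp_all add: arctan_le_iff)
    then show ?thesis
      unfolding V_def using that \<Gamma>mono[of X Y] \<Gamma>mono[of Y phi0]
      by (intro add_mono A_dec B_dec) (auto simp: \<theta>_def)
  qed
  show "x t < x s" if st: "t0 \<le> s" "s < t" "w s = x s" "w t = x t" "phi0 < x s" "phi0 < x t" for s t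
  proof (rule ccontr)
    assume "\<not> x t < x s"
    then have "E s \<le> E t" using V_inc[of "x s" "x t"] st by (simp add: E_V)
    then show False using E_strict[of s t] st by simp
  qed
  show "x s < x t" if st: "t0 \<le> s" "s < t" "w s = x s" "w t = x t" "x s < phi0" "x t < phi0" for s t
  proof (rule ccontr)
    assume "\<not> x s < x t"
    moreover have "0 < x t" using xbox[of t] st c by auto
    ultimately have "E s \<le> E t" using V_dec[of "x t" "x s"] st by (simp add: E_V)
    then show False using E_strict[of s t] st by simp
  qed
qed

section \<open>Linearization at the critical points and smoothness\<close>

text \<open>The first equation being \<open>\<phi>' = \<psi>\<close>, the Jacobian is a companion
  matrix: eigenvectors are multiples of \<open>(1, \<mu>)\<close>, and the second row becomes the
  characteristic equation.\<close>

lemma linearization_eigenvalues_companion: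
  fixes F :: "real^2 \<Rightarrow> real^2"
  assumes "(F has_derivative (\<lambda>v. vector [v $ 2, a * v $ 1 + b * v $ 2])) (at z)"
  shows "linearization_eigenvalues F z = {\<mu>. \<mu>\<^sup>2 = complex_of_real a + complex_of_real b * \<mu>}"
proof -
  let ?A = "map_matrix complex_of_real (jacobian F (at z))"
  have "jacobian F (at z) = matrix (\<lambda>v. vector [v $ 2, a * v $ 1 + b * v $ 2])"
    unfolding jacobian_def using frechet_derivative_at[OF assms] by simp
  then have A: "?A *v v = vector [v $ 2, of_real a * v $ 1 + of_real b * v $ 2]" for v :: "complex^2"
    by (simp add: vec_eq_iff forall_2 matrix_vector_mult_def sum_2 map_matrix_def matrix_def axis_def)
  have eig: "?A *v v = \<mu> *s v \<longleftrightarrow> v $ 2 = \<mu> * v $ 1 \<and> of_real a * v $ 1 + of_real b * v $ 2 = \<mu> * v $ 2"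
    for v :: "complex^2" and \<mu>
    unfolding A by (simp add: vec_eq_iff forall_2)
  show ?thesis
    unfolding linearization_eigenvalues_def
  proof (intro Collect_cong iffI)
    fix \<mu> :: complex
    assume "\<exists>v. v \<noteq> 0 \<and> ?A *v v = \<mu> *s v"
    then obtain v :: "complex^2" where v: "v \<noteq> 0" "v $ 2 = \<mu> * v $ 1"
      "of_real a * v $ 1 + of_real b * v $ 2 = \<mu> * v $ 2" unfolding eig by blast
    have "v $ 1 \<noteq> 0" using v(1,2) by (auto simp: vec_eq_iff forall_2)
    moreover have "(\<mu>\<^sup>2 - (of_real a + of_real b * \<mu>)) * v $ 1 = 0"
      using v(3) unfolding v(2) by (simp add: algebra_simps power2_eq_square)
    ultimately show "\<mu>\<^sup>2 = of_real a + of_real b * \<mu>" by simp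
  next
    fix \<mu> :: complex
    assume "\<mu>\<^sup>2 = of_real a + of_real b * \<mu>"
    then have "?A *v vector [1, \<mu>] = \<mu> *s vector [1, \<mu>]"
      unfolding eig by (simp add: power2_eq_square)
    moreover have "(vector [1, \<mu>] :: complex^2) \<noteq> 0" by (simp add: vec_eq_iff forall_2)
    ultimately show "\<exists>v. v \<noteq> 0 \<and> ?A *v v = \<mu> *s v" by blast
  qed
qed

lemma psi_rhs_split:
  assumes "lam\<^sup>2 * phi0\<^sup>2 = real p * lam\<^sup>2 - (real p + 1)"
  shows "psi_rhs (Suc p) p lam x y = - y - (1 + (x + y)\<^sup>2) *
    ((real p + 1 + lam\<^sup>2 * x\<^sup>2) / (1 + lam\<^sup>2 * x\<^sup>2) * y
     + lam\<^sup>2 * x * (x\<^sup>2 - phi0\<^sup>2) / (1 + lam\<^sup>2 * x\<^sup>2))"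
    (is "_ = _ - _ * ?B")
proof -
  have "w_rhs p lam x (x + y) = - (1 + (x + y)\<^sup>2) * ?B"
    using w_rhs_split[OF assms, of x "x + y"] by simp
  moreover have "psi_rhs (Suc p) p lam x y = w_rhs p lam x (x + y) - y"
    using psi_rhs_eq_w_rhs[of p lam x "x + y"] by simp
  moreover have "- (1 + (x + y)\<^sup>2) * b = - ((1 + (x + y)\<^sup>2) * b)" for b :: real
    by (rule mult_minus_left)
  ultimately show ?thesis by simp
qed

text \<open>Both critical points are treated at once through \<open>crit\<close>. There
  \<open>y = 0\<close> and \<open>G x0 = 0\<close>, so only the value of \<open>g\<close> and the
  slope of \<open>G\<close> survive in the derivative.\<close>

lemma system_field_has_derivative_at_critical:
  assumes eq: "lam\<^sup>2 * phi0\<^sup>2 = real p * lam\<^sup>2 - (real p + 1)"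
    and crit: "x0 * (x0\<^sup>2 - phi0\<^sup>2) = 0"
    and a: "a = - ((1 + x0\<^sup>2) * lam\<^sup>2 * (3 * x0\<^sup>2 - phi0\<^sup>2) / (1 + lam\<^sup>2 * x0\<^sup>2))"
    and b: "b = - 1 - (1 + x0\<^sup>2) * (real p + 1 + lam\<^sup>2 * x0\<^sup>2) / (1 + lam\<^sup>2 * x0\<^sup>2)"
  shows "system_field (Suc p) p lam (vector [x0, 0]) = 0"
    and "(system_field (Suc p) p lam has_derivative (\<lambda>v. vector [v $ 2, a * v $ 1 + b * v $ 2])) (at (vector [x0, 0]))"
proof -
  define g where "g x = (real p + 1 + lam\<^sup>2 * x\<^sup>2) / (1 + lam\<^sup>2 * x\<^sup>2)" for x
  define G where "G x = lam\<^sup>2 * x * (x\<^sup>2 - phi0\<^sup>2) / (1 + lam\<^sup>2 * x\<^sup>2)" for x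
  note D = one_plus_square_pos[of lam]
  have psi: "psi_rhs (Suc p) p lam x y = - y - (1 + (x + y)\<^sup>2) * (g x * y + G x)" for x y
    using psi_rhs_split[OF eq] by (simp add: g_def G_def)
  have G0: "G x0 = 0" using crit by (auto simp: G_def)
  show "system_field (Suc p) p lam (vector [x0, 0]) = 0"
    by (simp add: system_field_def psi G0 vec_eq_iff forall_2)
  define G' where "G' = lam\<^sup>2 * (3 * x0\<^sup>2 - phi0\<^sup>2) / (1 + lam\<^sup>2 * x0\<^sup>2)"
  have dG: "(G has_real_derivative G') (at x0)"
  proof -
    have num: "((\<lambda>x. lam\<^sup>2 * x * (x\<^sup>2 - phi0\<^sup>2)) has_real_derivative lam\<^sup>2 * (3 * x0\<^sup>2 - phi0\<^sup>2)) (at x0)"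
      by (auto intro!: derivative_eq_intros simp: algebra_simps power2_eq_square)
    have den: "((\<lambda>x. 1 + lam\<^sup>2 * x\<^sup>2) has_real_derivative lam\<^sup>2 * (2 * x0)) (at x0)"
      by (auto intro!: derivative_eq_intros)
    have "lam\<^sup>2 * x0 * (x0\<^sup>2 - phi0\<^sup>2) = 0" using crit by auto
    with DERIV_divide[OF num den] D[of x0] show ?thesis
      unfolding G_def G'_def by (simp add: divide_simps)
  qed
  \<comment> \<open>The value of \<open>g'\<close> is irrelevant, since it gets multiplied by
    \<open>y = 0\<close>.\<close>
  have "g differentiable (at x0)"
    unfolding g_def using D[of x0] by (intro derivative_intros) auto
  then obtain g' where dg: "(g has_real_derivative g') (at x0)"
    using real_differentiable_def by blast
  let ?z = "vector [x0, 0] :: real^2"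
  note nth = bounded_linear_imp_has_derivative[OF bounded_linear_vec_nth]
  have d1: "((\<lambda>z::real^2. g (z $ 1)) has_derivative (\<lambda>v. g' * v $ 1)) (at ?z)"
    by (rule has_derivative_compose[of "\<lambda>z. z $ 1" _ _ _ g "(*) g'"])
      (use dg in \<open>simp_all add: has_field_derivative_def bounded_linear_imp_has_derivative bounded_linear_vec_nth\<close>)
  have d2: "((\<lambda>z::real^2. G (z $ 1)) has_derivative (\<lambda>v. G' * v $ 1)) (at ?z)"
    by (rule has_derivative_compose[of "\<lambda>z. z $ 1" _ _ _ G "(*) G'"])
      (use dG in \<open>simp_all add: has_field_derivative_def bounded_linear_imp_has_derivative bounded_linear_vec_nth\<close>)
  have "((\<lambda>z::real^2. psi_rhs (Suc p) p lam (z $ 1) (z $ 2)) has_derivative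
      (\<lambda>v. - v $ 2 - (1 + x0\<^sup>2) * (g x0 * v $ 2 + G' * v $ 1))) (at ?z)"
    unfolding psi
    by (rule has_derivative_eq_rhs, (rule derivative_intros d1 d2 nth)+)
      (simp add: G0 fun_eq_iff algebra_simps)
  then have d3: "((\<lambda>z::real^2. psi_rhs (Suc p) p lam (z $ 1) (z $ 2)) has_derivative
      (\<lambda>v. a * v $ 1 + b * v $ 2)) (at ?z)"
    unfolding a b g_def G'_def by (simp add: algebra_simps)
  \<comment> \<open>A linear combination of fixed vectors is a form to which the derivative rules
    apply.\<close>
  have vec: "(vector [s, t] :: real^2) = s *\<^sub>R axis 1 1 + t *\<^sub>R axis 2 1" for s t
    by (simp add: vec_eq_iff forall_2 axis_def)
  show "(system_field (Suc p) p lam has_derivative (\<lambda>v. vector [v $ 2, a * v $ 1 + b * v $ 2])) (at ?z)"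
    unfolding system_field_def[abs_def] vec
    by (rule has_derivative_eq_rhs, (rule derivative_intros d3[unfolded vec] nth)+) simp
qed

text \<open>The condition on \<open>lam\<close> makes \<open>lam\<^sup>2 * phi0\<^sup>2\<close>
  factor as \<open>(k - 1) * (k + p + 1)\<close>, so the eigenvalues are \<open>k - 1\<close> and
  \<open>- (k + p + 1)\<close>; the positive one is the growth rate of the orbit.\<close>

lemma saddle_point_origin:
  fixes p k :: nat
  assumes k: "2 \<le> k" and lam: "real p * lam\<^sup>2 = real k * (real k + real p)"
    and eq: "lam\<^sup>2 * phi0\<^sup>2 = real p * lam\<^sup>2 - (real p + 1)"
  shows "saddle_point (system_field (Suc p) p lam) (vector [0, 0])"
proof -
  define a where "a = lam\<^sup>2 * phi0\<^sup>2"
  define b where "b = - (real p + 2)"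
  have a: "a = (real k - 1) * (real k + real p + 1)"
    unfolding a_def eq lam by (simp add: algebra_simps)
  note sys = system_field_has_derivative_at_critical[OF eq, of 0 a b]
  have ev: "linearization_eigenvalues (system_field (Suc p) p lam) (vector [0, 0])
      = {\<mu>. \<mu>\<^sup>2 = complex_of_real a + complex_of_real b * \<mu>}"
    by (rule linearization_eigenvalues_companion[OF sys(2)]) (simp_all add: a_def b_def)
  also have "\<dots> = {complex_of_real (- (real k + real p + 1)), complex_of_real (real k - 1)}"
  proof -
    have "\<mu>\<^sup>2 - (complex_of_real a + complex_of_real b * \<mu>)
        = (\<mu> - complex_of_real (- (real k + real p + 1))) * (\<mu> - complex_of_real (real k - 1))" for \<mu>
      by (simp add: a b_def algebra_simps power2_eq_square)
    then show ?thesis by (auto simp: eq_iff_diff_eq_0[of "_\<^sup>2"] simp del: of_real_diff of_real_minus)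
  qed
  finally have "linearization_eigenvalues (system_field (Suc p) p lam) (vector [0, 0])
      = {complex_of_real (- (real k + real p + 1)), complex_of_real (real k - 1)}" .
  moreover have "- (real k + real p + 1) < 0" "0 < real k - 1" using k by auto
  moreover have "system_field (Suc p) p lam (vector [0, 0]) = 0"
    by (rule sys(1)) (simp_all add: a_def b_def)
  moreover have "system_field (Suc p) p lam differentiable (at (vector [0, 0]))"
    unfolding differentiable_def by (rule exI, rule sys(2)) (simp_all add: a_def b_def)
  ultimately show ?thesis unfolding saddle_point_def critical_point_def by blast
qed

text \<open>The definition of \<open>phi0\<close> amounts to \<open>p * (1 + phi0\<^sup>2) *
  lam\<^sup>2 = (p + 1) * (1 + lam\<^sup>2 * phi0\<^sup>2)\<close>. The coefficients serve twice: in
  the linearization at the equilibrium and as limits along the orbit.\<close>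

lemma equilibrium_coefficients:
  fixes p :: nat
  assumes p: "0 < p" and eq: "lam\<^sup>2 * phi0\<^sup>2 = real p * lam\<^sup>2 - (real p + 1)" and phi0: "0 < phi0"
  shows "(1 + phi0\<^sup>2) * (real p + 1 + lam\<^sup>2 * phi0\<^sup>2) / (1 + lam\<^sup>2 * phi0\<^sup>2) = real p + 1"
    and "(1 + phi0\<^sup>2) * lam\<^sup>2 / (1 + lam\<^sup>2 * phi0\<^sup>2) = (real p + 1) / real p"
proof -
  have nz: "lam \<noteq> 0" using eq by auto
  define \<kappa> where "\<kappa> = lam\<^sup>2"
  define f where "f = phi0\<^sup>2"
  have k: "0 < \<kappa>" "0 < f" using nz phi0 by (auto simp: \<kappa>_def f_def)
  have e: "\<kappa> * f = real p * \<kappa> - (real p + 1)" using eq by (simp add: \<kappa>_def f_def)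
  have D: "0 < 1 + \<kappa> * f" using k by (simp add: add_pos_nonneg)
  have m: "real p * ((1 + f) * \<kappa>) = (real p + 1) * (1 + \<kappa> * f)"
    using e by (simp add: algebra_simps)
  show 2: "(1 + phi0\<^sup>2) * lam\<^sup>2 / (1 + lam\<^sup>2 * phi0\<^sup>2) = (real p + 1) / real p"
    using m D p by (simp add: \<kappa>_def[symmetric] f_def[symmetric] frac_eq_eq mult.commute)
  have "real p + 1 + lam\<^sup>2 * phi0\<^sup>2 = real p * lam\<^sup>2" using eq by simp
  then have "(1 + phi0\<^sup>2) * (real p + 1 + lam\<^sup>2 * phi0\<^sup>2) / (1 + lam\<^sup>2 * phi0\<^sup>2)
      = real p * ((1 + phi0\<^sup>2) * lam\<^sup>2 / (1 + lam\<^sup>2 * phi0\<^sup>2))" by simp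
  then show "(1 + phi0\<^sup>2) * (real p + 1 + lam\<^sup>2 * phi0\<^sup>2) / (1 + lam\<^sup>2 * phi0\<^sup>2) = real p + 1"
    unfolding 2 using p by simp
qed

text \<open>The characteristic polynomial has trace \<open>- (p + 2)\<close> and determinant
  \<open>\<beta>\<close>; \<open>disc\<close> says that its discriminant is negative, and the
  nonzero trace keeps the roots off the imaginary axis.\<close>

lemma spiral_point_equilibrium:
  fixes p :: nat
  assumes p: "0 < p" and eq: "lam\<^sup>2 * phi0\<^sup>2 = real p * lam\<^sup>2 - (real p + 1)" and phi0: "0 < phi0"
    and disc: "(real p + 2)\<^sup>2 < 4 * (2 * (real p + 1) / real p * phi0\<^sup>2)"
  shows "spiral_point (system_field (Suc p) p lam) (vector [phi0, 0])"
proof -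
  define \<beta> where "\<beta> = 2 * (real p + 1) / real p * phi0\<^sup>2"
  define s where "s = sqrt (\<beta> - (real p + 2)\<^sup>2 / 4)"
  have s: "0 < s" "s\<^sup>2 = \<beta> - (real p + 2)\<^sup>2 / 4" using disc by (simp_all add: s_def \<beta>_def)
  define \<omega> where "\<omega> = Complex (- (real p + 2) / 2) s"
  have a: "- \<beta> = - ((1 + phi0\<^sup>2) * lam\<^sup>2 * (3 * phi0\<^sup>2 - phi0\<^sup>2) / (1 + lam\<^sup>2 * phi0\<^sup>2))"
  proof -
    have "- ((1 + phi0\<^sup>2) * lam\<^sup>2 * (3 * phi0\<^sup>2 - phi0\<^sup>2) / (1 + lam\<^sup>2 * phi0\<^sup>2))
        = - ((1 + phi0\<^sup>2) * lam\<^sup>2 / (1 + lam\<^sup>2 * phi0\<^sup>2) * (2 * phi0\<^sup>2))" by simp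
    then show ?thesis unfolding equilibrium_coefficients(2)[OF p eq phi0] by (simp add: \<beta>_def)
  qed
  have b: "- (real p + 2) = - 1 - (1 + phi0\<^sup>2) * (real p + 1 + lam\<^sup>2 * phi0\<^sup>2) / (1 + lam\<^sup>2 * phi0\<^sup>2)"
    unfolding equilibrium_coefficients(1)[OF p eq phi0] by simp
  have crit: "phi0 * (phi0\<^sup>2 - phi0\<^sup>2) = 0" by simp
  note sys = system_field_has_derivative_at_critical[OF eq crit a b]
  have "linearization_eigenvalues (system_field (Suc p) p lam) (vector [phi0, 0])
      = {\<mu>. \<mu>\<^sup>2 = complex_of_real (- \<beta>) + complex_of_real (- (real p + 2)) * \<mu>}"
    by (rule linearization_eigenvalues_companion[OF sys(2)])
  also have "\<dots> = {\<omega>, cnj \<omega>}"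
  proof -
    have "\<omega> + cnj \<omega> = complex_of_real (- (real p + 2))" "\<omega> * cnj \<omega> = complex_of_real \<beta>"
      using s(2) by (simp_all add: \<omega>_def complex_eq_iff power2_eq_square field_simps)
    then have "\<mu>\<^sup>2 - (complex_of_real (- \<beta>) + complex_of_real (- (real p + 2)) * \<mu>)
        = \<mu>\<^sup>2 - (\<omega> + cnj \<omega>) * \<mu> + \<omega> * cnj \<omega>" for \<mu> by simp
    also have "\<dots> \<mu> = (\<mu> - \<omega>) * (\<mu> - cnj \<omega>)" for \<mu>
      by (simp add: algebra_simps power2_eq_square)
    finally show ?thesis by (auto simp: eq_iff_diff_eq_0[of "_\<^sup>2"] simp del: of_real_diff of_real_minus)
  qed
  finally have "linearization_eigenvalues (system_field (Suc p) p lam) (vector [phi0, 0]) = {\<omega>, cnj \<omega>}" .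
  moreover have "Re \<omega> \<noteq> 0" "Im \<omega> \<noteq> 0" using s(1) by (simp_all add: \<omega>_def)
  moreover have "system_field (Suc p) p lam differentiable (at (vector [phi0, 0]))"
    unfolding differentiable_def using sys(2) by blast
  ultimately show ?thesis
    unfolding spiral_point_def critical_point_def using sys(1) by blast
qed

text \<open>Polynomials in \<open>x\<close>, \<open>w\<close> and \<open>u = 1 / (1 + \<lambda>\<^sup>2 x\<^sup>2)\<close> along the orbit are closed under
  differentiation.\<close>

inductive_set generated_algebra :: "(real \<Rightarrow> real) \<Rightarrow> (real \<Rightarrow> real) \<Rightarrow> (real \<Rightarrow> real) \<Rightarrow> (real \<Rightarrow> real) set"
  for x w u where
  const: "(\<lambda>t. c) \<in> generated_algebra x w u"
| x: "x \<in> generated_algebra x w u"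
| w: "w \<in> generated_algebra x w u"
| u: "u \<in> generated_algebra x w u"
| add: "\<lbrakk>f \<in> generated_algebra x w u; g \<in> generated_algebra x w u\<rbrakk> \<Longrightarrow> (\<lambda>t. f t + g t) \<in> generated_algebra x w u"
| mult: "\<lbrakk>f \<in> generated_algebra x w u; g \<in> generated_algebra x w u\<rbrakk> \<Longrightarrow> (\<lambda>t. f t * g t) \<in> generated_algebra x w u"

lemma generated_algebra_diff:
  "\<lbrakk>f \<in> generated_algebra x w u; g \<in> generated_algebra x w u\<rbrakk> \<Longrightarrow> (\<lambda>t. f t - g t) \<in> generated_algebra x w u"
  using generated_algebra.add[OF _ generated_algebra.mult[OF generated_algebra.const[of "-1"]], of f x w u g] by simp

lemma smooth_if_closed_under_derivative:
  assumes "\<And>f. f \<in> S \<Longrightarrow> \<exists>f'\<in>S. \<forall>t. (f has_real_derivative f' t) (at t)" and "f \<in> S"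
  shows "smooth f"
proof -
  have "(deriv ^^ m) f \<in> S" for m
  proof (induction m)
    case (Suc m)
    obtain f' where f': "f' \<in> S" "\<And>t. ((deriv ^^ m) f has_real_derivative f' t) (at t)"
      using assms(1)[OF Suc] by blast
    have "deriv ((deriv ^^ m) f) = f'" using f'(2) by (auto intro: DERIV_imp_deriv)
    then show ?case using f'(1) by simp
  qed (simp add: assms(2))
  then show ?thesis
    unfolding smooth_def using assms(1) real_differentiable_def by blast
qed

lemma orbit_smooth:
  assumes dx: "\<And>t. (x has_real_derivative w t - x t) (at t)"
    and dw: "\<And>t. (w has_real_derivative w_rhs p lam (x t) (w t)) (at t)"
  shows "smooth x" and "smooth (\<lambda>t. w t - x t)"
proof -
  define u where "u t = 1 / (1 + lam\<^sup>2 * (x t)\<^sup>2)" for t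
  note alg = generated_algebra.intros[where x=x and w=w and u=u] generated_algebra_diff[where x=x and w=w and u=u]
  have du: "(u has_real_derivative - (u t * u t * (2 * lam\<^sup>2 * x t * (w t - x t)))) (at t)" for t
    unfolding u_def using one_plus_square_pos[of lam "x t"]
    by (auto intro!: derivative_eq_intros dx simp: power2_eq_square)
  have dw': "(w has_real_derivative - 1 * (1 + w t * w t) * ((real p + 1 + lam\<^sup>2 * (x t * x t)) * w t - real p * lam\<^sup>2 * x t) * u t) (at t)" for t
    using dw[of t] by (simp add: w_rhs_def u_def power2_eq_square)
  have closed: "\<exists>f'\<in>generated_algebra x w u. \<forall>t. (f has_real_derivative f' t) (at t)" if "f \<in> generated_algebra x w u" for f
    using that
  proof induction
    case (const c)
    show ?case by (rule bexI[of _ "\<lambda>t. 0"]) (auto intro: alg)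
  next
    case x
    show ?case by (rule bexI[of _ "\<lambda>t. w t - x t"]) (auto intro: alg dx)
  next
    case w
    have "(\<lambda>t. - 1 * (1 + w t * w t) * ((real p + 1 + lam\<^sup>2 * (x t * x t)) * w t - real p * lam\<^sup>2 * x t) * u t)
        \<in> generated_algebra x w u"
      by (intro alg)
    then show ?case by (rule bexI[rotated]) (intro allI dw')
  next
    case u
    have "(\<lambda>t. (-1) * (u t * u t * (2 * lam\<^sup>2 * x t * (w t - x t)))) \<in> generated_algebra x w u"
      by (intro alg)
    then show ?case using du by force
  next
    case (add f g)
    then obtain f' g' where "f' \<in> generated_algebra x w u" "g' \<in> generated_algebra x w u"
      "\<forall>t. (f has_real_derivative f' t) (at t)" "\<forall>t. (g has_real_derivative g' t) (at t)" by blast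
    then show ?case by (intro bexI[of _ "\<lambda>t. f' t + g' t"]) (auto intro: alg DERIV_add)
  next
    case (mult f g)
    then obtain f' g' where *: "f' \<in> generated_algebra x w u" "g' \<in> generated_algebra x w u"
      "\<forall>t. (f has_real_derivative f' t) (at t)" "\<forall>t. (g has_real_derivative g' t) (at t)" by blast
    then have "\<forall>t. ((\<lambda>t. f t * g t) has_real_derivative f' t * g t + g' t * f t) (at t)"
      by (auto intro: DERIV_mult)
    moreover have "(\<lambda>t. f' t * g t + g' t * f t) \<in> generated_algebra x w u"
      using * mult by (intro alg)
    ultimately show ?case by (rule bexI)
  qed
  show "smooth x" by (rule smooth_if_closed_under_derivative[OF closed]) (auto intro: alg)
  show "smooth (\<lambda>t. w t - x t)" by (rule smooth_if_closed_under_derivative[OF closed]) (auto intro: alg)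
qed

section \<open>The spiralling orbit\<close>

lemma exponential_bound_tendsto_zero:
  fixes f :: "real \<Rightarrow> real"
  assumes "0 < r" "\<And>t. t \<le> t0 \<Longrightarrow> \<bar>f t\<bar> \<le> C * exp (r * t)"
  shows "(f \<longlongrightarrow> 0) at_bot" and "f \<in> O[at_bot](\<lambda>t. exp (r * t))"
proof -
  have ev: "eventually (\<lambda>t. \<bar>f t\<bar> \<le> C * exp (r * t)) at_bot"
    using assms(2) by (auto simp: eventually_at_bot_linorder)
  have "filterlim (\<lambda>t. r * t) at_bot at_bot"
    by (rule filterlim_tendsto_pos_mult_at_bot[OF tendsto_const assms(1) filterlim_ident])
  then have "((\<lambda>t. exp (r * t)) \<longlongrightarrow> 0) at_bot"
    by (rule filterlim_compose[OF exp_at_bot])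
  then have lim: "((\<lambda>t. C * exp (r * t)) \<longlongrightarrow> 0) at_bot" by (rule tendsto_mult_right_zero)
  show "(f \<longlongrightarrow> 0) at_bot" by (rule Lim_null_comparison[OF _ lim]) (use ev in simp)
  show "f \<in> O[at_bot](\<lambda>t. exp (r * t))" by (rule bigoI[of _ C]) (use ev in simp)
qed

text \<open>Because the restoring force contains the factor \<open>x - phi0\<close>, the difference
  \<open>X = x - phi0\<close> satisfies exactly \<open>X'' = - P * X' - Q * X\<close>, with the
  nonlinearity hidden in coefficients evaluated on the orbit. They are bounded on the box and
  converge to minus the trace and to the determinant of the linearization, which is where
  \<open>disc\<close> enters.\<close>

lemma spiral_orbit:
  fixes p k :: nat
  assumes k: "2 \<le> k" and p: "0 < p" and lam: "0 < lam" "real p * lam\<^sup>2 = real k * (real k + real p)"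
    and phi0: "0 < phi0" and eq: "lam\<^sup>2 * phi0\<^sup>2 = real p * lam\<^sup>2 - (real p + 1)"
    and disc: "(real p + 2)\<^sup>2 < 4 * (2 * (real p + 1) / real p * phi0\<^sup>2)"
  obtains x w T :: "_ \<Rightarrow> real" and t0 C :: real
  where "\<And>t. (x has_real_derivative w t - x t) (at t)"
    "\<And>t. (w has_real_derivative w_rhs p lam (x t) (w t)) (at t)"
    "\<And>t. 0 < w t"
    "\<And>t. t \<le> t0 \<Longrightarrow> x t < w t"
    "\<And>t. t \<le> t0 \<Longrightarrow> \<bar>x t\<bar> \<le> C * exp ((real k - 1) * t)"
    "\<And>t. t \<le> t0 \<Longrightarrow> \<bar>w t - x t\<bar> \<le> C * exp ((real k - 1) * t)"
    "(x \<longlongrightarrow> phi0) at_top" "((\<lambda>t. w t - x t) \<longlongrightarrow> 0) at_top"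
    "T (0::nat) = t0" "strict_mono T" "filterlim T at_top sequentially"
    "\<And>i. 1 \<le> i \<Longrightarrow> w (T i) = x (T i)"
    "\<And>i t. T i < t \<Longrightarrow> t < T (Suc i) \<Longrightarrow> 0 < (-1) ^ i * (w t - x t)"
    "\<And>i j. odd i \<Longrightarrow> odd j \<Longrightarrow> i < j \<Longrightarrow> x (T j) < x (T i)"
    "\<And>i j. even i \<Longrightarrow> even j \<Longrightarrow> 0 < i \<Longrightarrow> i < j \<Longrightarrow> x (T i) < x (T j)"
proof -
  obtain x w t0 c M C where
    dx: "\<And>t. (x has_real_derivative w t - x t) (at t)" and
    dw: "\<And>t. (w has_real_derivative w_rhs p lam (x t) (w t)) (at t)" and
    pos: "\<And>t. t \<le> t0 \<Longrightarrow> 0 < x t" "\<And>t. t \<le> t0 \<Longrightarrow> x t < w t" and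
    bd: "\<And>t. t \<le> t0 \<Longrightarrow> \<bar>x t\<bar> \<le> C * exp ((real k - 1) * t)"
    "\<And>t. t \<le> t0 \<Longrightarrow> \<bar>w t\<bar> \<le> C * exp ((real k - 1) * t)" and
    box: "\<And>t. t0 \<le> t \<Longrightarrow> x t \<in> {c..M}" "\<And>t. t0 \<le> t \<Longrightarrow> w t \<in> {c..M}" and c: "0 < c" and M: "phi0 \<le> M"
    by (rule global_orbit[OF k lam(2), of phi0]) (rule that)
  note lyap = lyapunov_consequences[where ?t0.0=t0, OF dx dw box c lam(1) phi0 M eq]
  define D where "D X = 1 + lam\<^sup>2 * X\<^sup>2" for X
  have D: "1 \<le> D X" "D X \<noteq> 0" for X
    using one_plus_square_pos[of lam X] by (auto simp: D_def)
  define P where "P t = 1 + (1 + (w t)\<^sup>2) * (real p + 1 + lam\<^sup>2 * (x t)\<^sup>2) / D (x t)" for t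
  define Q where "Q t = (1 + (w t)\<^sup>2) * (lam\<^sup>2 * x t * (x t + phi0)) / D (x t)" for t
  define y where "y t = w t - x t" for t
  define X where "X t = x t - phi0" for t
  have dX: "(X has_real_derivative y t) (at t)" for t
    unfolding X_def y_def by (auto intro!: derivative_eq_intros dx)
  have rhs: "w_rhs p lam (x t) (w t) - y t = - P t * y t - Q t * X t" for t
  proof -
    have "w_rhs p lam (x t) (w t) = - (1 + (w t)\<^sup>2) * ((real p + 1 + lam\<^sup>2 * (x t)\<^sup>2) / D (x t) * y t
        + lam\<^sup>2 * x t * ((x t)\<^sup>2 - phi0\<^sup>2) / D (x t))"
      unfolding D_def y_def by (rule w_rhs_split[OF eq])
    also have "\<dots> = - ((1 + (w t)\<^sup>2) * (real p + 1 + lam\<^sup>2 * (x t)\<^sup>2) / D (x t)) * y t - Q t * X t"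
      using D(2)[of "x t"] by (simp add: Q_def X_def divide_simps) (simp add: algebra_simps power2_eq_square)
    finally show ?thesis by (simp add: P_def algebra_simps)
  qed
  have dy: "(y has_real_derivative - P t * y t - Q t * X t) (at t)" for t
    using DERIV_diff[OF dw dx, of t] rhs[of t] unfolding y_def[abs_def] by simp
  define K where "K = max (1 + (1 + M\<^sup>2) * (real p + 1 + lam\<^sup>2 * M\<^sup>2)) ((1 + M\<^sup>2) * (lam\<^sup>2 * M * (M + phi0)))"
  have PQ: "\<bar>P t\<bar> \<le> K \<and> \<bar>Q t\<bar> \<le> K \<and> 0 < Q t" if t: "t0 \<le> t" for t
  proof -
    have b: "0 < x t" "x t \<le> M" "0 < w t" "w t \<le> M" using box[OF t] c by auto
    have sq: "(x t)\<^sup>2 \<le> M\<^sup>2" "(w t)\<^sup>2 \<le> M\<^sup>2" using b by (auto intro: power_mono)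
    have le: "a / D (x t) \<le> a" if "0 \<le> a" for a
      using D(1)[of "x t"] that by (simp add: divide_le_eq mult_le_cancel_left1)
    have n1: "0 \<le> (1 + (w t)\<^sup>2) * (real p + 1 + lam\<^sup>2 * (x t)\<^sup>2)"
      by (intro mult_nonneg_nonneg add_nonneg_nonneg) auto
    have n2: "0 < (1 + (w t)\<^sup>2) * (lam\<^sup>2 * x t * (x t + phi0))"
      using b phi0 lam by (intro mult_pos_pos add_pos_nonneg) auto
    have "(1 + (w t)\<^sup>2) * (real p + 1 + lam\<^sup>2 * (x t)\<^sup>2) \<le> (1 + M\<^sup>2) * (real p + 1 + lam\<^sup>2 * M\<^sup>2)"
      using sq by (intro mult_mono add_mono) auto
    then have "P t \<le> 1 + (1 + M\<^sup>2) * (real p + 1 + lam\<^sup>2 * M\<^sup>2)"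
      unfolding P_def using le[OF n1] by linarith
    moreover have "0 \<le> P t" unfolding P_def using n1 D(1)[of "x t"] by (intro add_nonneg_nonneg divide_nonneg_pos) auto
    moreover have "(1 + (w t)\<^sup>2) * (lam\<^sup>2 * x t * (x t + phi0)) \<le> (1 + M\<^sup>2) * (lam\<^sup>2 * M * (M + phi0))"
      using sq b phi0 by (intro mult_mono add_mono) auto
    then have "Q t \<le> (1 + M\<^sup>2) * (lam\<^sup>2 * M * (M + phi0))"
      unfolding Q_def using le[OF less_imp_le[OF n2]] by linarith
    moreover have "0 < Q t" unfolding Q_def using n2 D(1)[of "x t"] by (intro divide_pos_pos) auto
    ultimately show ?thesis by (auto simp: K_def)
  qed
  have xlim: "(x \<longlongrightarrow> phi0) at_top" by (rule lyap(1))
  then have Xlim: "(X \<longlongrightarrow> 0) at_top" unfolding X_def by (simp add: LIM_zero)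
  have ylim: "(y \<longlongrightarrow> 0) at_top"
  proof (rule derivative_tendsto_zero[OF dX dy _ Xlim])
    fix t assume t: "t0 \<le> t"
    have "\<bar>y t\<bar> \<le> M" "\<bar>X t\<bar> \<le> M" using box[OF t] c M phi0 by (auto simp: y_def X_def)
    then have "\<bar>P t\<bar> * \<bar>y t\<bar> + \<bar>Q t\<bar> * \<bar>X t\<bar> \<le> K * M + K * M"
      using PQ[OF t] by (intro add_mono mult_mono) auto
    then show "\<bar>- P t * y t - Q t * X t\<bar> \<le> K * M + K * M"
      by (intro order_trans[OF abs_triangle_ineq4]) (simp add: abs_mult)
  qed
  have "((\<lambda>t. x t + y t) \<longlongrightarrow> phi0 + 0) at_top" by (intro tendsto_add xlim ylim)
  then have wlim: "(w \<longlongrightarrow> phi0) at_top" by (simp add: y_def)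
  have D0: "1 + lam\<^sup>2 * phi0\<^sup>2 \<noteq> 0" using one_plus_square_pos[of lam phi0] by simp
  have "(P \<longlongrightarrow> 1 + (1 + phi0\<^sup>2) * (real p + 1 + lam\<^sup>2 * phi0\<^sup>2) / (1 + lam\<^sup>2 * phi0\<^sup>2)) at_top"
    unfolding P_def D_def by (intro tendsto_intros xlim wlim D0)
  then have Plim: "(P \<longlongrightarrow> real p + 2) at_top"
    unfolding equilibrium_coefficients(1)[OF p eq phi0] by (simp add: add.commute)
  have "(Q \<longlongrightarrow> (1 + phi0\<^sup>2) * (lam\<^sup>2 * phi0 * (phi0 + phi0)) / (1 + lam\<^sup>2 * phi0\<^sup>2)) at_top"
    unfolding Q_def D_def by (intro tendsto_intros xlim wlim D0)
  also have "(1 + phi0\<^sup>2) * (lam\<^sup>2 * phi0 * (phi0 + phi0)) / (1 + lam\<^sup>2 * phi0\<^sup>2)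
      = (1 + phi0\<^sup>2) * lam\<^sup>2 / (1 + lam\<^sup>2 * phi0\<^sup>2) * (2 * phi0\<^sup>2)"
    by (simp add: power2_eq_square mult_ac)
  also have "\<dots> = 2 * (real p + 1) / real p * phi0\<^sup>2"
    unfolding equilibrium_coefficients(2)[OF p eq phi0] by simp
  finally have Qlim: "(Q \<longlongrightarrow> 2 * (real p + 1) / real p * phi0\<^sup>2) at_top" .
  have y0: "0 < y t0" using pos(2)[of t0] by (simp add: y_def)
  obtain T :: "nat \<Rightarrow> real" where T: "T 0 = t0" "strict_mono T" "filterlim T at_top sequentially"
    and zero: "\<And>i. 1 \<le> i \<Longrightarrow> y (T i) = 0"
    and sgn: "\<And>i t. T i < t \<Longrightarrow> t < T (Suc i) \<Longrightarrow> 0 < (-1) ^ i * y t"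
    and xsgn: "\<And>i. 1 \<le> i \<Longrightarrow> (-1) ^ i * X (T i) < 0"
    by (rule damped_oscillator_zero_sequence[of t0 X y P Q K, OF dX dy _ _ _ Plim Qlim disc Xlim y0])
      (use PQ in blast)+
  have T_ge: "t0 \<le> T i" for i using strict_mono_less_eq[OF T(2), of 0 i] T(1) by simp
  have meet: "w (T i) = x (T i)" if "1 \<le> i" for i using zero[OF that] by (simp add: y_def)
  show thesis
  \<comment> \<open>The factor 2 pays for estimating \<open>w - x\<close> by the triangle
    inequality.\<close>
  proof (rule that[of x w t0 "2 * C" T])
    show "0 < w t" for t
      using pos[of t] box(2)[of t] c by (cases "t \<le> t0") auto
    have C: "0 \<le> C * exp ((real k - 1) * t)" if "t \<le> t0" for t using bd(1)[OF that] by linarith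
    show "\<bar>x t\<bar> \<le> 2 * C * exp ((real k - 1) * t)" if "t \<le> t0" for t
      using bd(1)[OF that] C[OF that] by linarith
    show "\<bar>w t - x t\<bar> \<le> 2 * C * exp ((real k - 1) * t)" if "t \<le> t0" for t
      using bd[OF that] by linarith
    \<comment> \<open>By \<open>xsgn\<close> the odd turning points lie above \<open>phi0\<close>
      and the even ones below, so each parity stays on one side, as the energy comparison
      requires.\<close>
    show "x (T j) < x (T i)" if "odd i" "odd j" "i < j" for i j
    proof -
      have "1 \<le> i" "1 \<le> j" using that odd_pos[of i] by auto
      then show ?thesis
        using lyap(2)[OF _ _ T_ge, of i "T j"] that xsgn[of i] xsgn[of j] meet strict_monoD[OF T(2) that(3)]
        by (simp add: X_def)
    qed
    show "x (T i) < x (T j)" if "even i" "even j" "0 < i" "i < j" for i j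
    proof -
      have "1 \<le> i" "1 \<le> j" using that by auto
      then show ?thesis
        using lyap(3)[OF _ _ T_ge, of i "T j"] that xsgn[of i] xsgn[of j] meet strict_monoD[OF T(2) that(4)]
        by (simp add: X_def)
    qed
  qed (use dx dw pos xlim ylim T meet sgn in \<open>auto simp: y_def[abs_def]\<close>)
qed

theorem proposition3p4:
  fixes n p k :: nat and lam phi0 :: real
  assumes "even k" and "k > 0"
    and "(n = 3 \<and> p = 2 \<and> k \<ge> 4) \<or> (n = 5 \<and> p = 4 \<and> k \<ge> 6)"
    and "lam = sqrt (real k * (real k + real n - 1) / real p)"
    and "phi0 = sqrt ((real p - real n / lam\<^sup>2) / (real n - real p))"
  shows "(\<exists>(\<phi> :: real \<Rightarrow> real) (\<psi> :: real \<Rightarrow> real) (T :: nat \<Rightarrow> real).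
      smooth \<phi> \<and> smooth \<psi>
    \<and> (\<forall>t. (\<phi> has_real_derivative \<psi> t) (at t))
    \<and> (\<forall>t. (\<psi> has_real_derivative psi_rhs n p lam (\<phi> t) (\<psi> t)) (at t))
    \<and> strict_mono_on {1..} T
    \<and> ((\<lambda>t. (\<phi> t, \<psi> t)) \<longlongrightarrow> (0, 0)) at_bot
    \<and> \<phi> \<in> O[at_bot](\<lambda>t. exp ((real k - 1) * t))
    \<and> \<psi> \<in> O[at_bot](\<lambda>t. exp ((real k - 1) * t))
    \<and> ((\<lambda>t. (\<phi> t, \<psi> t)) \<longlongrightarrow> (phi0, 0)) at_top
    \<and> filterlim T at_top sequentially
    \<and> (\<forall>i\<ge>1. \<psi> (T i) = 0)
    \<and> strict_antimono_on {1..} (\<lambda>m. \<phi> (T (2 * m - 1)))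
    \<and> strict_mono_on {1..} (\<lambda>m. \<phi> (T (2 * m)))
    \<and> (\<lambda>m. \<phi> (T (2 * m - 1))) \<longlonglongrightarrow> phi0
    \<and> (\<lambda>m. \<phi> (T (2 * m))) \<longlonglongrightarrow> phi0
    \<and> (\<forall>t \<in> {..<T 1} \<union> (\<Union>m\<in>{1..}. {T (2 * m)<..<T (2 * m + 1)}). \<psi> t > 0)
    \<and> (\<forall>t \<in> (\<Union>m\<in>{1..}. {T (2 * m - 1)<..<T (2 * m)}). \<psi> t < 0)
    \<and> (\<forall>t. \<phi> t + \<psi> t > 0))
    \<and> saddle_point (system_field n p lam) (vector [0, 0])
    \<and> spiral_point (system_field n p lam) (vector [phi0, 0])"
proof -
  have n: "n = Suc p" and k: "2 \<le> k" and p: "0 < p" using assms(3) by auto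
  have np: "real n - real p = 1" "real n - 1 = real p" "real n = real p + 1" by (simp_all add: n)
  have kp: "0 < real k * (real k + real p)" using assms(2) by simp
  have "lam\<^sup>2 = real k * (real k + real p) / real p"
    unfolding assms(4) using kp np(2) by (simp add: add_diff_eq[symmetric])
  then have lam: "real p * lam\<^sup>2 = real k * (real k + real p)" using p by simp
  have lam0: "0 < lam" unfolding assms(4) using kp p np(2) by (simp add: add_diff_eq[symmetric])
  have ratio: "(real p + 1) / lam\<^sup>2 = real p * (real p + 1) / (real k * (real k + real p))"
    unfolding lam[symmetric] using p by simp
  have disc_k: "(real p + 2)\<^sup>2 * (real k * (real k + real p)) < 8 * (real p + 1) * (real k * (real k + real p) - (real p + 1))"
    using assms(3)
  proof
    assume *: "n = 3 \<and> p = 2 \<and> 4 \<le> k"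
    then have "4 * (4 + 2) \<le> real k * (real k + 2)" by (intro mult_mono) auto
    then show ?thesis using * by simp
  next
    assume *: "n = 5 \<and> p = 4 \<and> 6 \<le> k"
    then have "6 * (6 + 4) \<le> real k * (real k + 4)" by (intro mult_mono) auto
    then show ?thesis using * by simp
  qed
  have "0 \<le> (real p + 2)\<^sup>2 * (real k * (real k + real p))" using kp by simp
  then have "0 < 8 * (real p + 1) * (real k * (real k + real p) - (real p + 1))" using disc_k by linarith
  then have gt: "real p + 1 < real k * (real k + real p)" by (simp add: zero_less_mult_iff)
  have pos: "0 < real p - (real p + 1) / lam\<^sup>2"
    using gt lam lam0 by (simp add: pos_divide_less_eq)
  have phi0_sq: "phi0\<^sup>2 = real p - (real p + 1) / lam\<^sup>2"
    unfolding assms(5) using pos by (simp add: np)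
  have phi0: "0 < phi0" unfolding assms(5) using pos by (simp add: np)
  have eq: "lam\<^sup>2 * phi0\<^sup>2 = real p * lam\<^sup>2 - (real p + 1)"
    unfolding phi0_sq using lam0 by (simp add: right_diff_distrib)
  have disc: "(real p + 2)\<^sup>2 < 4 * (2 * (real p + 1) / real p * phi0\<^sup>2)"
  proof -
    have "4 * (2 * (real p + 1) / real p * phi0\<^sup>2)
        = 8 * (real p + 1) * (real k * (real k + real p) - (real p + 1)) / (real k * (real k + real p))"
    proof -
      have "4 * (2 * (q + 1) / q * (q - q * (q + 1) / K)) = 8 * (q + 1) * (K - (q + 1)) / K"
        if "0 < q" "0 < K" for q K :: real
        using that by (simp add: field_simps)
      then show ?thesis unfolding phi0_sq ratio using p kp by simp
    qed
    then show ?thesis using disc_k kp by (simp add: pos_less_divide_eq)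
  qed
  obtain x w :: "real \<Rightarrow> real" and T t0 C where
    dx: "\<And>t. (x has_real_derivative w t - x t) (at t)" and
    dw: "\<And>t. (w has_real_derivative w_rhs p lam (x t) (w t)) (at t)" and
    wpos: "\<And>t. 0 < w t" and early: "\<And>t. t \<le> t0 \<Longrightarrow> x t < w t" and
    bd: "\<And>t. t \<le> t0 \<Longrightarrow> \<bar>x t\<bar> \<le> C * exp ((real k - 1) * t)"
    "\<And>t. t \<le> t0 \<Longrightarrow> \<bar>w t - x t\<bar> \<le> C * exp ((real k - 1) * t)" and
    lim: "(x \<longlongrightarrow> phi0) at_top" "((\<lambda>t. w t - x t) \<longlongrightarrow> 0) at_top" and
    T: "T (0::nat) = t0" "strict_mono T" "filterlim T at_top sequentially" and
    zero: "\<And>i. 1 \<le> i \<Longrightarrow> w (T i) = x (T i)" and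
    sgn: "\<And>i t. T i < t \<Longrightarrow> t < T (Suc i) \<Longrightarrow> 0 < (-1) ^ i * (w t - x t)" and
    anti: "\<And>i j. odd i \<Longrightarrow> odd j \<Longrightarrow> i < j \<Longrightarrow> x (T j) < x (T i)" and
    mono: "\<And>i j. even i \<Longrightarrow> even j \<Longrightarrow> 0 < i \<Longrightarrow> i < j \<Longrightarrow> x (T i) < x (T j)"
    by (rule spiral_orbit[OF k p lam0 lam phi0 eq disc]) (rule that)
  have dpsi: "((\<lambda>t. w t - x t) has_real_derivative psi_rhs n p lam (x t) (w t - x t)) (at t)" for t
    unfolding n psi_rhs_eq_w_rhs by (rule DERIV_diff[OF dw dx])
  have k1: "0 < real k - 1" using k by simp
  have small: "(f \<longlongrightarrow> 0) at_bot" "f \<in> O[at_bot](\<lambda>t. exp ((real k - 1) * t))"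
    if "\<And>t. t \<le> t0 \<Longrightarrow> \<bar>f t\<bar> \<le> C * exp ((real k - 1) * t)" for f
    using exponential_bound_tendsto_zero[where ?t0.0=t0 and C=C and f=f, OF k1] that by auto
  have subseq: "(\<lambda>m. x (T (f m))) \<longlonglongrightarrow> phi0" if "filterlim f at_top sequentially" for f
    using filterlim_compose[OF lim(1) filterlim_compose[OF T(3) that]] .
  \<comment> \<open>On natural numbers \<open>2 * m - 1\<close> is 0 at \<open>m = 0\<close>, an
    index that is not a turning point; this does not affect the limits, and the monotonicity claims
    start at 1.\<close>
  have up: "filterlim (\<lambda>m::nat. 2 * m) at_top sequentially" "filterlim (\<lambda>m::nat. 2 * m - 1) at_top sequentially"
  proof -
    have "\<exists>N. \<forall>m\<ge>N. Z \<le> 2 * m \<and> Z \<le> 2 * m - 1" for Z :: nat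
      by (rule exI[of _ "Suc Z"]) auto
    then show "filterlim (\<lambda>m::nat. 2 * m) at_top sequentially" "filterlim (\<lambda>m::nat. 2 * m - 1) at_top sequentially"
      unfolding filterlim_at_top eventually_sequentially by meson+
  qed
  have psi_pos: "0 < w t - x t" if "t \<in> {..<T 1} \<union> (\<Union>m\<in>{1..}. {T (2 * m)<..<T (2 * m + 1)})" for t
  proof -
    have "t < T 1 \<or> (\<exists>m. T (2 * m) < t \<and> t < T (Suc (2 * m)))"
      using that by auto
    \<comment> \<open>The range before \<open>T 1\<close> consists of the early part of the orbit up
      to \<open>T 0 = t0\<close> and the interval with \<open>m = 0\<close>, on which the
      alternating sign is positive as well.\<close>
    then have "t \<le> t0 \<or> (\<exists>m. T (2 * m) < t \<and> t < T (Suc (2 * m)))"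
      using T(1) by (metis One_nat_def mult_0_right not_le)
    then show ?thesis using early sgn by force
  qed
  have psi_neg: "w t - x t < 0" if "t \<in> (\<Union>m\<in>{1..}. {T (2 * m - 1)<..<T (2 * m)})" for t
  proof -
    from that obtain m where m: "1 \<le> m" "T (2 * m - 1) < t" "t < T (2 * m)" by auto
    then have "odd (2 * m - 1)" "Suc (2 * m - 1) = 2 * m" by auto
    then show ?thesis using sgn[of "2 * m - 1" t] m by simp
  qed
  have "strict_antimono_on {1..} (\<lambda>m. x (T (2 * m - 1)))"
    by (rule monotone_onI, rule anti) auto
  moreover have "strict_mono_on {1..} (\<lambda>m. x (T (2 * m)))"
    by (rule monotone_onI, rule mono) auto
  moreover have "strict_mono_on {1..} T"
    by (rule monotone_onI) (rule strict_monoD[OF T(2)])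
  moreover have "((\<lambda>t. (x t, w t - x t)) \<longlongrightarrow> (0, 0)) at_bot"
    using small(1)[of x, OF bd(1)] small(1)[of "\<lambda>t. w t - x t", OF bd(2)] by (intro tendsto_Pair)
  moreover have "((\<lambda>t. (x t, w t - x t)) \<longlongrightarrow> (phi0, 0)) at_top"
    by (intro tendsto_Pair lim)
  moreover have "saddle_point (system_field n p lam) (vector [0, 0])"
    unfolding n by (rule saddle_point_origin[OF k lam eq])
  moreover have "spiral_point (system_field n p lam) (vector [phi0, 0])"
    unfolding n by (rule spiral_point_equilibrium[OF p eq phi0 disc])
  ultimately show ?thesis
    using orbit_smooth[OF dx dw] dx dpsi T(3) zero subseq[OF up(1)] subseq[OF up(2)] psi_pos psi_neg wpos
      small(2)[of x, OF bd(1)] small(2)[of "\<lambda>t. w t - x t", OF bd(2)]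
    by (intro conjI exI[of _ x] exI[of _ "\<lambda>t. w t - x t"] exI[of _ T]) auto
qed

end
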